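(* Let $(M,\rho)$ be a pointed metric space. Then: (1) If $M$ is not uniformly discrete, that is, if $\inf\{\rho(t,s): t,s\in M,\ t\neq s\}=0$ (for every $\eta>0$ there are distinct $t,s\in M$ with $\rho(t,s)<\eta$), then $\mathrm{Lip}_0(M)$ has the USD2P. (2) If $M$ is compact, then $\mathrm{Lip}_0(M)$ has the USD2P if and only if $M$ is infinite. (3) If $M$ is not bounded, then $\mathrm{Lip}_0(M)$ has the USD2P.
   Context: A pointed metric space is a metric space $M$ with a distinguished element $0\in M$. $\mathrm{Lip}_0(M)$ is the real Banach space of all Lipschitz functions $f:M\to\mathbb{R}$ with $f(0)=0$, with norm $\|f\|=\sup\{\frac{f(x)-f(y)}{\rho(x,y)}: x,y\in M,\ x\ne y\}$ (equal to $0$ if $M$ is a single point). $B_X$ is the closed unit ball of a Banach space $X$. A slice of $B_X$ is a set $S(B_X,f,\alpha)=\{x\in B_X: f(x)>\sup f(B_X)-\alpha\}$ with $f\in X^*$, $\alpha>0$. A convex combination of slices of $B_X$ is a set $\sum_{i=1}^n\lambda_iS_i=\{\sum_{i=1}^n\lambda_i x_i: x_i\in S_i\}$ with $n\in\mathbb{N}$, $\lambda_i>0$, $\sum_{i=1}^n\lambda_i=1$ and each $S_i$ a slice of $B_X$. $X$ has the strong diameter two property (SD2P) if every convex combination of slices of $B_X$ has diameter $2$. For an ultrafilter $\mathcal{U}$ over $\mathbb{N}$, the ultrapower is $X_{\mathcal{U}}=\ell_\infty(\mathbb{N},X)/\{f\in\ell_\infty(\mathbb{N},X):\lim_{\mathcal{U}}\|f(n)\|=0\}$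 with the quotient norm. $X$ has the uniform strong diameter two property (USD2P) if $X_{\mathcal{U}}$ has the SD2P for every free ultrafilter $\mathcal{U}$ over $\mathbb{N}$. *)

theory Defs
  imports "HOL-Analysis.Analysis"
begin

section \<open>Real normed spaces with explicit carrier\<close>

text \<open>
  The space \<open>Lip\<^sub>0(M)\<close> depends on the base point and the ultrapower depends on the ultrafilter,
  so neither can be a type of class \<open>banach\<close>. Normed spaces are therefore records. The record
  itself imposes no axioms; the notions below are meant for records that are real normed spaces,
  with all operations considered only on the carrier.
\<close>

record 'v nspace =
  vcarrier :: "'v set"
  vzero :: 'v
  vadd :: "'v \<Rightarrow> 'v \<Rightarrow> 'v"
  vscale :: "real \<Rightarrow> 'v \<Rightarrow> 'v"
  vnorm :: "'v \<Rightarrow> real"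

definition vdiff :: "'v nspace \<Rightarrow> 'v \<Rightarrow> 'v \<Rightarrow> 'v" where
  "vdiff X x y = vadd X x (vscale X (- 1) y)"

definition unit_ball :: "'v nspace \<Rightarrow> 'v set" where
  "unit_ball X = {x \<in> vcarrier X. vnorm X x \<le> 1}"

text \<open>Functionals are total functions on \<open>'v\<close>; their values off the carrier are irrelevant.\<close>

definition dual_space :: "'v nspace \<Rightarrow> ('v \<Rightarrow> real) set" where
  "dual_space X = {f.
     (\<forall>x \<in> vcarrier X. \<forall>y \<in> vcarrier X. f (vadd X x y) = f x + f y) \<and>
     (\<forall>c. \<forall>x \<in> vcarrier X. f (vscale X c x) = c * f x) \<and>
     (\<exists>K. \<forall>x \<in> vcarrier X. \<bar>f x\<bar> \<le> K * vnorm X x)}"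

text \<open>Same convention as for \<^const>\<open>diameter\<close>.\<close>

definition vdiameter :: "'v nspace \<Rightarrow> 'v set \<Rightarrow> real" where
  "vdiameter X S = (if S = {} then 0 else SUP (x, y) \<in> S \<times> S. vnorm X (vdiff X x y))"

section \<open>Slices and the strong diameter two property\<close>

definition slice :: "'v nspace \<Rightarrow> ('v \<Rightarrow> real) \<Rightarrow> real \<Rightarrow> 'v set" where
  "slice X f \<alpha> = {x \<in> unit_ball X. f x > Sup (f ` unit_ball X) - \<alpha>}"

definition is_slice :: "'v nspace \<Rightarrow> 'v set \<Rightarrow> bool" where
  "is_slice X S \<longleftrightarrow> (\<exists>f \<in> dual_space X. \<exists>\<alpha> > 0. S = slice X f \<alpha>)"

primrec lincomb :: "'v nspace \<Rightarrow> (nat \<Rightarrow> real) \<Rightarrow> (nat \<Rightarrow> 'v) \<Rightarrow> nat \<Rightarrow> 'v" where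
  "lincomb X l x 0 = vzero X"
| "lincomb X l x (Suc n) = vadd X (lincomb X l x n) (vscale X (l n) (x n))"

text \<open>Indices run over \<open>{..<n}\<close>; \<open>n \<ge> 1\<close> is forced by the weights having sum 1.\<close>

definition is_convex_comb_slices :: "'v nspace \<Rightarrow> 'v set \<Rightarrow> bool" where
  "is_convex_comb_slices X C \<longleftrightarrow>
     (\<exists>(n::nat) l S. (\<forall>i<n. l i > 0 \<and> is_slice X (S i)) \<and> (\<Sum>i<n. l i) = 1 \<and>
        C = {lincomb X l x n |x. \<forall>i<n. x i \<in> S i})"

definition SD2P :: "'v nspace \<Rightarrow> bool" where
  "SD2P X \<longleftrightarrow> (\<forall>C. is_convex_comb_slices X C \<longrightarrow> vdiameter X C = 2)"

section \<open>Ultrapowers\<close>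

definition linf_space :: "'v nspace \<Rightarrow> (nat \<Rightarrow> 'v) nspace" where
  "linf_space X =
    \<lparr> vcarrier = {g. (\<forall>n. g n \<in> vcarrier X) \<and> bdd_above (range (\<lambda>n. vnorm X (g n)))},
      vzero = (\<lambda>n. vzero X),
      vadd = (\<lambda>g h n. vadd X (g n) (h n)),
      vscale = (\<lambda>c g n. vscale X c (g n)),
      vnorm = (\<lambda>g. SUP n. vnorm X (g n)) \<rparr>"

text \<open>
  Elements of the quotient by a subspace \<open>N\<close> are the cosets \<open>x + N\<close>. Adding \<open>N\<close> in the scalar
  multiplication only matters for the scalar 0, where the pointwise product would be \<open>{0}\<close>
  instead of \<open>N\<close>. The norm of a coset is the infimum of the norms of its elements.
\<close>

definition vcoset :: "'v nspace \<Rightarrow> 'v set \<Rightarrow> 'v \<Rightarrow> 'v set" where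
  "vcoset X N x = {vadd X x z |z. z \<in> N}"

definition quotient_nspace :: "'v nspace \<Rightarrow> 'v set \<Rightarrow> 'v set nspace" where
  "quotient_nspace X N =
    \<lparr> vcarrier = vcoset X N ` vcarrier X,
      vzero = N,
      vadd = (\<lambda>A B. {vadd X a b |a b. a \<in> A \<and> b \<in> B}),
      vscale = (\<lambda>c A. {vadd X (vscale X c a) z |a z. a \<in> A \<and> z \<in> N}),
      vnorm = (\<lambda>A. INF a \<in> A. vnorm X a) \<rparr>"

definition free_ultrafilter :: "'i filter \<Rightarrow> bool" where
  "free_ultrafilter U \<longleftrightarrow>
     U \<noteq> bot \<and> (\<forall>P. eventually P U \<or> eventually (\<lambda>i. \<not> P i) U) \<and>
     (\<forall>j. \<not> eventually (\<lambda>i. i = j) U)"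

definition ultrapower :: "'v nspace \<Rightarrow> nat filter \<Rightarrow> (nat \<Rightarrow> 'v) set nspace" where
  "ultrapower X U = quotient_nspace (linf_space X)
     {g \<in> vcarrier (linf_space X). ((\<lambda>n. vnorm X (g n)) \<longlongrightarrow> 0) U}"

definition USD2P :: "'v nspace \<Rightarrow> bool" where
  "USD2P X \<longleftrightarrow> (\<forall>U. free_ultrafilter U \<longrightarrow> SD2P (ultrapower X U))"

section \<open>Spaces of Lipschitz functions\<close>

text \<open>
  The pointed metric space is a type of class \<open>metric_space\<close> with base point \<open>p\<close>. The case
  distinction is needed because \<open>Sup {}\<close> is not 0 by definition on the reals.
\<close>

definition Lip0 :: "'a::metric_space \<Rightarrow> ('a \<Rightarrow> real) nspace" where
  "Lip0 p =
    \<lparr> vcarrier = {f. (\<exists>L. L-lipschitz_on UNIV f) \<and> f p = 0},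
      vzero = (\<lambda>x. 0),
      vadd = (\<lambda>f g x. f x + g x),
      vscale = (\<lambda>c f x. c * f x),
      vnorm = (\<lambda>f. if UNIV = {p} then 0
                   else Sup {(f x - f y) / dist x y |x y. x \<noteq> y}) \<rparr>"

end

theory Submission
  imports Defs
begin

text \<open>
  Suppose that \<open>M\<close> has arbitrarily many pairs of distinct points \<open>(t, s)\<close> such that the annuli
  around \<open>s\<close> with radii \<open>r d\<close> and \<open>d / r\<close>, where \<open>d\<close> is the distance of \<open>t\<close> and \<open>s\<close>, are pairwise
  disjoint; \<open>r > 0\<close> is as small as we like. A function \<open>f\<close> of norm at most \<open>1 - \<epsilon>\<close> can be
  changed inside such an annulus so that its slope between \<open>t\<close> and \<open>s\<close> becomes \<open>1 - \<epsilon>\<close>, or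
  \<open>\<epsilon> - 1\<close>, while the norm stays at most 1. Sums of changes with disjoint supports are uniformly
  bounded, hence any finitely many functionals are almost unaffected by one of them, and the two
  changed families witness that a convex combination of slices has diameter 2. All bounds are
  uniform, and representatives in an ultrapower can be changed coordinatewise.

  If \<open>M\<close> is unbounded, or if there are pairs of distinct points at distances tending to 0 with
  Cauchy second components, annuli around a single point with lacunary radii will do. If the second
  components have no Cauchy subsequence, they contain a separated sequence, and balls around its
  points are disjoint. If \<open>M\<close> is finite, the functional \<open>f \<mapsto> \<Sum>\<^sub>x f x\<close> extends to the
  ultrapower along the ultrafilter and determines slices of small diameter, since it attains its
  maximum only at the distance function to the base point.
\<close>

section \<open>Seminormed spaces with explicit carrier\<close>

text \<open>The records carry no axioms, so the laws on the carrier are collected here, to be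
  verified for \<open>Lip0 p\<close>, \<open>linf_space\<close> and quotients. Homogeneity is asked
  for as an inequality only, the half that is immediate for norms defined as suprema and
  infima.\<close>

locale seminormed =
  fixes X :: "'v nspace"
  assumes zero_closed [simp]: "vzero X \<in> vcarrier X"
    and add_closed [simp]: "\<lbrakk>x \<in> vcarrier X; y \<in> vcarrier X\<rbrakk> \<Longrightarrow> vadd X x y \<in> vcarrier X"
    and scale_closed [simp]: "x \<in> vcarrier X \<Longrightarrow> vscale X c x \<in> vcarrier X"
    and add_assoc: "\<lbrakk>x \<in> vcarrier X; y \<in> vcarrier X; z \<in> vcarrier X\<rbrakk>
      \<Longrightarrow> vadd X (vadd X x y) z = vadd X x (vadd X y z)"
    and add_commute: "\<lbrakk>x \<in> vcarrier X; y \<in> vcarrier X\<rbrakk> \<Longrightarrow> vadd X x y = vadd X y x"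
    and add_zero [simp]: "x \<in> vcarrier X \<Longrightarrow> vadd X x (vzero X) = x"
    and scale_add: "\<lbrakk>x \<in> vcarrier X; y \<in> vcarrier X\<rbrakk>
      \<Longrightarrow> vscale X c (vadd X x y) = vadd X (vscale X c x) (vscale X c y)"
    and add_scale: "x \<in> vcarrier X \<Longrightarrow> vscale X (a + b) x = vadd X (vscale X a x) (vscale X b x)"
    and scale_scale: "x \<in> vcarrier X \<Longrightarrow> vscale X a (vscale X b x) = vscale X (a * b) x"
    and scale_one [simp]: "x \<in> vcarrier X \<Longrightarrow> vscale X 1 x = x"
    and scale_zero [simp]: "x \<in> vcarrier X \<Longrightarrow> vscale X 0 x = vzero X"
    and norm_add: "\<lbrakk>x \<in> vcarrier X; y \<in> vcarrier X\<rbrakk>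
      \<Longrightarrow> vnorm X (vadd X x y) \<le> vnorm X x + vnorm X y"
    and norm_scale_le: "x \<in> vcarrier X \<Longrightarrow> vnorm X (vscale X c x) \<le> \<bar>c\<bar> * vnorm X x"
begin

lemma add_left_commute:
  "\<lbrakk>x \<in> vcarrier X; y \<in> vcarrier X; z \<in> vcarrier X\<rbrakk>
    \<Longrightarrow> vadd X x (vadd X y z) = vadd X y (vadd X x z)"
  by (metis add_assoc add_commute)

lemma zero_add [simp]: "x \<in> vcarrier X \<Longrightarrow> vadd X (vzero X) x = x"
  using add_commute[of x "vzero X"] by simp

lemma diff_closed [simp]: "\<lbrakk>x \<in> vcarrier X; y \<in> vcarrier X\<rbrakk> \<Longrightarrow> vdiff X x y \<in> vcarrier X"
  by (simp add: vdiff_def)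

lemma diff_self [simp]: "x \<in> vcarrier X \<Longrightarrow> vdiff X x x = vzero X"
  using add_scale[of x 1 "-1"] by (simp add: vdiff_def)

lemma norm_zero: "vnorm X (vzero X) = 0"
proof -
  have "vnorm X (vzero X) \<le> 0"
    using norm_scale_le[of "vzero X" 0] by simp
  moreover have "vnorm X (vzero X) \<le> vnorm X (vzero X) + vnorm X (vzero X)"
    using norm_add[of "vzero X" "vzero X"] by simp
  ultimately show ?thesis by simp
qed

text \<open>The zero vector is \<open>x\<close> plus its negative, so 0 is at most twice the norm of
  \<open>x\<close>.\<close>

lemma norm_nonneg: "x \<in> vcarrier X \<Longrightarrow> 0 \<le> vnorm X x"
  using norm_add[of x "vscale X (-1) x"] norm_scale_le[of x "-1"] diff_self[of x]
  by (simp add: vdiff_def norm_zero)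

lemma norm_diff_le:
  "\<lbrakk>x \<in> vcarrier X; y \<in> vcarrier X\<rbrakk> \<Longrightarrow> vnorm X (vdiff X x y) \<le> vnorm X x + vnorm X y"
  using norm_add[of x "vscale X (-1) y"] norm_scale_le[of y "-1"] by (simp add: vdiff_def)

lemma zero_in_unit_ball: "vzero X \<in> unit_ball X"
  by (simp add: unit_ball_def norm_zero)

lemma lincomb_closed:
  "(\<And>i. i < n \<Longrightarrow> x i \<in> vcarrier X) \<Longrightarrow> lincomb X l x n \<in> vcarrier X"
  by (induction n) auto

lemma norm_lincomb_le:
  assumes "\<And>i. i < n \<Longrightarrow> x i \<in> vcarrier X"
  shows "vnorm X (lincomb X l x n) \<le> (\<Sum>i<n. \<bar>l i\<bar> * vnorm X (x i))"
  using assms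
proof (induction n)
  case 0
  then show ?case by (simp add: norm_zero)
next
  case (Suc n)
  have "vnorm X (lincomb X l x (Suc n))
      \<le> vnorm X (lincomb X l x n) + vnorm X (vscale X (l n) (x n))"
    using Suc.prems by (auto intro!: norm_add lincomb_closed)
  then show ?case
    using Suc norm_scale_le[of "x n" "l n"] by simp
qed

lemma dual_lincomb:
  assumes "f \<in> dual_space X" and "\<And>i. i < n \<Longrightarrow> x i \<in> vcarrier X"
  shows "f (lincomb X l x n) = (\<Sum>i<n. l i * f (x i))"
  using assms(2)
proof (induction n)
  case 0
  have "f (vscale X 0 (vzero X)) = 0 * f (vzero X)"
    using assms(1) zero_closed unfolding dual_space_def by blast
  then show ?case by simp
next
  case (Suc n)
  have "f (lincomb X l x (Suc n)) = f (lincomb X l x n) + f (vscale X (l n) (x n))"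
    using assms(1) lincomb_closed[of n x l] Suc.prems unfolding dual_space_def by simp
  also have "f (vscale X (l n) (x n)) = l n * f (x n)"
    using assms(1) Suc.prems unfolding dual_space_def by simp
  finally show ?case using Suc by simp
qed

lemma dual_diff:
  assumes "f \<in> dual_space X" "x \<in> vcarrier X" "y \<in> vcarrier X"
  shows "f (vdiff X x y) = f x - f y"
  using assms unfolding dual_space_def vdiff_def by simp

lemma dual_bdd_above:
  assumes "f \<in> dual_space X"
  shows "bdd_above (f ` unit_ball X)"
proof -
  obtain L where L: "\<And>x. x \<in> vcarrier X \<Longrightarrow> \<bar>f x\<bar> \<le> L * vnorm X x"
    using assms unfolding dual_space_def by blast
  have "f x \<le> \<bar>L\<bar>" if "x \<in> unit_ball X" for x
  proof -
    have "f x \<le> L * vnorm X x" "0 \<le> vnorm X x" "vnorm X x \<le> 1"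
      using L[of x] norm_nonneg[of x] that by (auto simp: unit_ball_def)
    moreover have "L * vnorm X x \<le> \<bar>L\<bar> * 1"
      using calculation by (intro mult_mono) auto
    ultimately show ?thesis by simp
  qed
  then show ?thesis by (auto simp: bdd_above_def)
qed

lemma convex_comb_in_unit_ball:
  assumes "\<And>i. i < n \<Longrightarrow> x i \<in> unit_ball X" "\<And>i. i < n \<Longrightarrow> 0 \<le> l i" "(\<Sum>i<n. l i) = 1"
  shows "lincomb X l x n \<in> unit_ball X"
proof -
  have "vnorm X (lincomb X l x n) \<le> (\<Sum>i<n. \<bar>l i\<bar> * vnorm X (x i))"
    using assms(1) by (intro norm_lincomb_le) (auto simp: unit_ball_def)
  also have "\<dots> \<le> (\<Sum>i<n. l i * 1)"
    using assms(1,2) by (intro sum_mono mult_mono) (auto simp: unit_ball_def norm_nonneg)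
  finally show ?thesis
    using assms by (auto simp: unit_ball_def intro!: lincomb_closed)
qed

end

lemma lincomb_cong:
  "(\<And>i. i < n \<Longrightarrow> x i = y i) \<Longrightarrow> lincomb X l x n = lincomb X l y n"
  by (induction n) auto

section \<open>Spreadable spaces\<close>

text \<open>
  The perturbations \<open>G \<sigma> k i - f i\<close>, \<open>k < K\<close>, behave like a \<open>c\<^sub>0\<close>-sequence, so a functional can be
  large on only few of them. The constant \<open>C\<close> does not depend on \<open>K\<close>, \<open>n\<close>, \<open>\<epsilon>\<close>, \<open>f\<close>; this
  uniformity is what survives in ultrapowers.
\<close>

definition spreads :: "'v nspace \<Rightarrow> real \<Rightarrow> nat \<Rightarrow> nat \<Rightarrow> real \<Rightarrow> (nat \<Rightarrow> 'v) \<Rightarrow>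
    (bool \<Rightarrow> nat \<Rightarrow> nat \<Rightarrow> 'v) \<Rightarrow> bool" where
  "spreads X C K n \<epsilon> f G \<longleftrightarrow>
    (\<forall>\<sigma>. \<forall>k<K. \<forall>i<n. G \<sigma> k i \<in> unit_ball X) \<and>
    (\<forall>\<sigma>. \<forall>i<n. \<forall>\<theta>. (\<forall>k<K. \<bar>\<theta> k\<bar> \<le> 1) \<longrightarrow>
      vnorm X (lincomb X \<theta> (\<lambda>k. vdiff X (G \<sigma> k i) (f i)) K) \<le> C) \<and>
    (\<forall>k<K. \<forall>l. (\<forall>i<n. 0 \<le> l i) \<and> (\<Sum>i<n. l i) = 1 \<longrightarrow>
      2 * (1 - \<epsilon>) \<le> vnorm X (vdiff X (lincomb X l (G True k) n) (lincomb X l (G False k) n)))"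

definition spreadable :: "'v nspace \<Rightarrow> real \<Rightarrow> bool" where
  "spreadable X C \<longleftrightarrow>
    (\<forall>K n \<epsilon> f. 0 < \<epsilon> \<and> \<epsilon> < 1 \<and> (\<forall>i<n. f i \<in> vcarrier X \<and> vnorm X (f i) \<le> 1 - \<epsilon>) \<longrightarrow>
      (\<exists>G. spreads X C K n \<epsilon> f G))"

lemma spreadsD:
  assumes "spreads X C K n \<epsilon> f G"
  shows "\<lbrakk>k < K; i < n\<rbrakk> \<Longrightarrow> G \<sigma> k i \<in> unit_ball X"
    and "\<lbrakk>i < n; \<And>k. k < K \<Longrightarrow> \<bar>\<theta> k\<bar> \<le> 1\<rbrakk>
      \<Longrightarrow> vnorm X (lincomb X \<theta> (\<lambda>k. vdiff X (G \<sigma> k i) (f i)) K) \<le> C"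
    and "\<lbrakk>k < K; \<And>i. i < n \<Longrightarrow> 0 \<le> l i; (\<Sum>i<n. l i) = 1\<rbrakk>
      \<Longrightarrow> 2 * (1 - \<epsilon>) \<le> vnorm X (vdiff X (lincomb X l (G True k) n) (lincomb X l (G False k) n))"
  using assms unfolding spreads_def by blast+

text \<open>The combination of the \<open>w k\<close> with the signs of \<open>f (w k)\<close> as
  coefficients has norm at most \<open>C\<close>, and \<open>f\<close> maps it to the sum of the
  absolute values. The bound does not grow with \<open>K\<close>.\<close>

lemma (in seminormed) sum_abs_dual_le:
  assumes "f \<in> dual_space X" and w: "\<And>k. k < K \<Longrightarrow> w k \<in> vcarrier X"
    and L: "\<And>x. x \<in> vcarrier X \<Longrightarrow> \<bar>f x\<bar> \<le> L * vnorm X x"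
    and C: "\<And>\<theta>. (\<And>k. k < K \<Longrightarrow> \<bar>\<theta> k\<bar> \<le> 1) \<Longrightarrow> vnorm X (lincomb X \<theta> w K) \<le> C"
  shows "(\<Sum>k<K. \<bar>f (w k)\<bar>) \<le> \<bar>L\<bar> * C"
proof -
  let ?y = "lincomb X (\<lambda>k. sgn (f (w k))) w K"
  have y: "?y \<in> vcarrier X" using w by (rule lincomb_closed)
  have "(\<Sum>k<K. \<bar>f (w k)\<bar>) = f ?y"
    using assms(1) w by (subst dual_lincomb) (auto intro!: sum.cong simp: abs_sgn mult.commute)
  also have "\<dots> \<le> L * vnorm X ?y" using L[OF y] by simp
  also have "\<dots> \<le> \<bar>L\<bar> * C"
    using norm_nonneg[OF y] by (intro mult_mono C) (auto simp: abs_sgn_eq)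
  finally show ?thesis .
qed

text \<open>Take points \<open>b i\<close> that almost attain the suprema, shrink them to make room,
  and spread them in \<open>K\<close> ways. Over all \<open>k < K\<close> the changes of each
  functional have a bounded sum, so for large \<open>K\<close> a single \<open>k\<close> changes all
  the \<open>\<phi> i\<close> little, for both signs at once.\<close>

lemma (in seminormed) spreadable_imp_slices:
  assumes spr: "spreadable X C"
    and \<phi>: "\<And>i. i < n \<Longrightarrow> \<phi> i \<in> dual_space X" and \<alpha>: "\<And>i. i < n \<Longrightarrow> \<alpha> i > 0"
    and l: "\<And>i. i < n \<Longrightarrow> 0 \<le> l i" "(\<Sum>i<n. l i) = 1" and e: "0 < e" "e < 1"
  shows "\<exists>x y. (\<forall>i<n. x i \<in> slice X (\<phi> i) (\<alpha> i)) \<and> (\<forall>i<n. y i \<in> slice X (\<phi> i) (\<alpha> i)) \<and>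
    2 * (1 - e) \<le> vnorm X (vdiff X (lincomb X l x n) (lincomb X l y n))"
proof -
  define s where "s i = Sup (\<phi> i ` unit_ball X)" for i
  have "\<exists>x\<in>unit_ball X. s i - \<alpha> i / 2 < \<phi> i x" if "i < n" for i
    using that zero_in_unit_ball \<phi>[OF that] \<alpha>[OF that]
      less_cSup_iff[of "\<phi> i ` unit_ball X" "s i - \<alpha> i / 2"] dual_bdd_above[of "\<phi> i"]
    by (auto simp: s_def)
  then obtain b where b: "\<And>i. i < n \<Longrightarrow> b i \<in> unit_ball X"
    "\<And>i. i < n \<Longrightarrow> s i - \<alpha> i / 2 < \<phi> i (b i)"
    by metis
  \<comment> \<open>Shrinking \<open>b i\<close> by the factor \<open>1 - t\<close> costs
    \<open>t * \<phi> i (b i)\<close> in the functional; a small \<open>t\<close> keeps this below a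
    quarter of \<open>\<alpha> i\<close>.\<close>
  have "\<forall>\<^sub>F t in at_right 0. t * \<phi> i (b i) < \<alpha> i / 4" if "i < n" for i
  proof -
    have "((\<lambda>t. t * \<phi> i (b i)) \<longlongrightarrow> 0 * \<phi> i (b i)) (at_right 0)"
      by (intro tendsto_intros)
    then show ?thesis using \<alpha>[OF that] by (intro order_tendstoD(2)) auto
  qed
  then have "\<forall>\<^sub>F t in at_right 0. \<forall>i\<in>{..<n}. t * \<phi> i (b i) < \<alpha> i / 4"
    by (intro eventually_ball_finite) auto
  moreover have "\<forall>\<^sub>F t in at_right 0. t \<in> {0<..<e}"
    using e by (intro eventually_at_right_real)
  ultimately have "\<forall>\<^sub>F t in at_right 0. (\<forall>i\<in>{..<n}. t * \<phi> i (b i) < \<alpha> i / 4) \<and> t \<in> {0<..<e}"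
    by (rule eventually_conj)
  then have "\<exists>t. (\<forall>i\<in>{..<n}. t * \<phi> i (b i) < \<alpha> i / 4) \<and> t \<in> {0<..<e}"
    by (rule eventually_happens'[OF trivial_limit_at_right_real])
  then obtain \<epsilon> where \<epsilon>: "\<And>i. i < n \<Longrightarrow> \<epsilon> * \<phi> i (b i) < \<alpha> i / 4" "0 < \<epsilon>" "\<epsilon> < e"
    by (metis greaterThanLessThan_iff lessThan_iff)
  define f where "f i = vscale X (1 - \<epsilon>) (b i)" for i
  have f: "f i \<in> vcarrier X" "vnorm X (f i) \<le> 1 - \<epsilon>" "\<phi> i (f i) > s i - 3 * \<alpha> i / 4" if "i < n" for i
  proof -
    have "vnorm X (f i) \<le> \<bar>1 - \<epsilon>\<bar> * vnorm X (b i)"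
      unfolding f_def using b(1)[OF that] by (intro norm_scale_le) (auto simp: unit_ball_def)
    also have "\<dots> \<le> \<bar>1 - \<epsilon>\<bar> * 1"
      using b(1)[OF that] by (intro mult_left_mono) (auto simp: unit_ball_def)
    finally show "vnorm X (f i) \<le> 1 - \<epsilon>" using \<epsilon> e by simp
    show "f i \<in> vcarrier X" using b(1)[OF that] by (simp add: f_def unit_ball_def)
    have "\<phi> i (f i) = (1 - \<epsilon>) * \<phi> i (b i)"
      using b(1)[OF that] \<phi>[OF that] by (simp add: f_def unit_ball_def dual_space_def)
    then show "\<phi> i (f i) > s i - 3 * \<alpha> i / 4"
      using \<epsilon>(1)[OF that] b(2)[OF that] by (simp add: algebra_simps)
  qed
  have "\<exists>L. \<forall>x\<in>vcarrier X. \<bar>\<phi> i x\<bar> \<le> L * vnorm X x" if "i < n" for i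
    using \<phi>[OF that] unfolding dual_space_def by blast
  then obtain L where L: "\<And>i x. \<lbrakk>i < n; x \<in> vcarrier X\<rbrakk> \<Longrightarrow> \<bar>\<phi> i x\<bar> \<le> L i * vnorm X x"
    by metis
  \<comment> \<open>\<open>K\<close> exceeds the bound, independent of \<open>K\<close>, on the sum
    over all \<open>k\<close>, both signs and all \<open>i\<close> of the normalized changes
    \<open>D\<close> introduced below.\<close>
  obtain K :: nat where K: "real K > (\<Sum>(\<sigma>::bool, i)\<in>UNIV \<times> {..<n}. 4 / \<alpha> i * (\<bar>L i\<bar> * C))"
    using reals_Archimedean2 by blast
  have "0 < \<epsilon> \<and> \<epsilon> < 1 \<and> (\<forall>i<n. f i \<in> vcarrier X \<and> vnorm X (f i) \<le> 1 - \<epsilon>)"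
    using \<epsilon> e f by auto
  with spr obtain G where spreads: "spreads X C K n \<epsilon> f G"
    unfolding spreadable_def by blast
  note G = spreadsD(1)[OF spreads] and GC = spreadsD(2)[OF spreads] and Gl = spreadsD(3)[OF spreads]
  \<comment> \<open>Scaled so that \<open>D \<sigma> k i < 1\<close> means a change of
    \<open>\<phi> i\<close> by less than \<open>\<alpha> i / 4\<close>.\<close>
  define D where "D \<sigma> k i = 4 / \<alpha> i * \<bar>\<phi> i (vdiff X (G \<sigma> k i) (f i))\<bar>" for \<sigma> k i
  have D0: "0 \<le> D \<sigma> k i" if "i < n" for \<sigma> k i
    using \<alpha>[OF that] by (simp add: D_def)
  have Dsum: "(\<Sum>k<K. D \<sigma> k i) \<le> 4 / \<alpha> i * (\<bar>L i\<bar> * C)" if "i < n" for \<sigma> i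
    unfolding D_def sum_distrib_left[symmetric]
    using \<alpha>[OF that] G[OF _ that] f(1)[OF that] GC[OF that] L[OF that] \<phi>[OF that]
    by (intro mult_left_mono sum_abs_dual_le) (auto simp: unit_ball_def)
  \<comment> \<open>Pigeonhole: if each \<open>k\<close> had a pair of \<open>\<sigma>\<close> and
    \<open>i\<close> with \<open>D \<sigma> k i\<close> at least 1, the sum over all
    \<open>k\<close> and all pairs would be at least \<open>K\<close>.\<close>
  have "\<exists>k<K. \<forall>\<sigma>. \<forall>i<n. D \<sigma> k i < 1"
  proof (rule ccontr)
    assume neg: "\<not> ?thesis"
    have "1 \<le> (\<Sum>(\<sigma>, i)\<in>UNIV \<times> {..<n}. D \<sigma> k i)" if "k < K" for k
    proof -
      obtain \<sigma> i where i: "i < n" "1 \<le> D \<sigma> k i"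
        using neg \<open>k < K\<close> by (meson not_less)
      have "D \<sigma> k i \<le> (\<Sum>(\<sigma>, i)\<in>UNIV \<times> {..<n}. D \<sigma> k i)"
        using i D0 member_le_sum[of "(\<sigma>, i)" "UNIV \<times> {..<n}" "\<lambda>(\<sigma>, i). D \<sigma> k i"] by auto
      with i show ?thesis by simp
    qed
    then have "(\<Sum>k<K. 1) \<le> (\<Sum>k<K. \<Sum>(\<sigma>, i)\<in>UNIV \<times> {..<n}. D \<sigma> k i)"
      by (intro sum_mono) auto
    also have "\<dots> = (\<Sum>(\<sigma>, i)\<in>UNIV \<times> {..<n}. \<Sum>k<K. D \<sigma> k i)"
      by (subst sum.swap) (auto intro!: sum.cong)
    also have "\<dots> \<le> (\<Sum>(\<sigma>::bool, i)\<in>UNIV \<times> {..<n}. 4 / \<alpha> i * (\<bar>L i\<bar> * C))"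
      using Dsum by (intro sum_mono) auto
    finally show False using K by simp
  qed
  then obtain k where k: "k < K" "\<And>\<sigma> i. i < n \<Longrightarrow> D \<sigma> k i < 1" by blast
  have "G \<sigma> k i \<in> slice X (\<phi> i) (\<alpha> i)" if "i < n" for \<sigma> i
  proof -
    have "\<bar>\<phi> i (vdiff X (G \<sigma> k i) (f i))\<bar> < \<alpha> i / 4"
      using k(2)[OF that, of \<sigma>] \<alpha>[OF that] by (simp add: D_def field_simps)
    then have "\<bar>\<phi> i (G \<sigma> k i) - \<phi> i (f i)\<bar> < \<alpha> i / 4"
      using G[OF k(1) that] f(1)[OF that] \<phi>[OF that] by (subst (asm) dual_diff) (auto simp: unit_ball_def)
    \<comment> \<open>Of the admissible loss \<open>\<alpha> i\<close>, one half is spent on the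
      choice of \<open>b i\<close>, a quarter on shrinking and a quarter on spreading.\<close>
    then have "s i - \<alpha> i < \<phi> i (G \<sigma> k i)" using f(3)[OF that] by linarith
    then show ?thesis using G[OF k(1) that] by (simp add: slice_def s_def)
  qed
  moreover have "2 * (1 - e) \<le> vnorm X (vdiff X (lincomb X l (G True k) n) (lincomb X l (G False k) n))"
    using Gl[OF k(1) l] \<epsilon> by simp
  ultimately show ?thesis by blast
qed

lemma (in seminormed) spreadable_imp_SD2P:
  assumes "spreadable X C"
  shows "SD2P X"
  unfolding SD2P_def
proof (intro allI impI)
  fix S assume "is_convex_comb_slices X S"
  then obtain n l T where T: "\<And>i. i < n \<Longrightarrow> l i > 0" "\<And>i. i < n \<Longrightarrow> is_slice X (T i)"
    "(\<Sum>i<n. l i) = 1" and S: "S = {lincomb X l x n |x. \<forall>i<n. x i \<in> T i}"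
    unfolding is_convex_comb_slices_def by blast
  obtain \<phi> \<alpha> where \<phi>: "\<And>i. i < n \<Longrightarrow> \<phi> i \<in> dual_space X"
    "\<And>i. i < n \<Longrightarrow> \<alpha> i > 0" "\<And>i. i < n \<Longrightarrow> T i = slice X (\<phi> i) (\<alpha> i)"
    using T(2) unfolding is_slice_def by metis
  have ball: "S \<subseteq> unit_ball X"
    using T \<phi>(3) unfolding S by (auto intro!: convex_comb_in_unit_ball simp: slice_def less_imp_le)
  have le: "vnorm X (vdiff X x y) \<le> 2" if "x \<in> S" "y \<in> S" for x y
  proof -
    have "x \<in> unit_ball X" "y \<in> unit_ball X" using ball that by auto
    then show ?thesis using norm_diff_le[of x y] by (simp add: unit_ball_def)
  qed
  have ge: "\<exists>x\<in>S. \<exists>y\<in>S. 2 * (1 - e) \<le> vnorm X (vdiff X x y)" if e: "0 < e" "e < 1" for e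
  proof -
    obtain x y where "\<And>i. i < n \<Longrightarrow> x i \<in> T i" "\<And>i. i < n \<Longrightarrow> y i \<in> T i"
      "2 * (1 - e) \<le> vnorm X (vdiff X (lincomb X l x n) (lincomb X l y n))"
      using spreadable_imp_slices[OF assms, of n \<phi> \<alpha> l e] \<phi> T(1,3) e by (auto simp: less_imp_le)
    then show ?thesis unfolding S by blast
  qed
  have ne: "S \<noteq> {}" using ge[of "1/2"] by auto
  have bdd: "bdd_above ((\<lambda>(x, y). vnorm X (vdiff X x y)) ` (S \<times> S))"
    using le by (auto simp: bdd_above_def)
  have "(SUP (x, y)\<in>S \<times> S. vnorm X (vdiff X x y)) = 2"
  proof (rule antisym)
    show "(SUP (x, y)\<in>S \<times> S. vnorm X (vdiff X x y)) \<le> 2"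
      using ne le by (intro cSUP_least) auto
    show "2 \<le> (SUP (x, y)\<in>S \<times> S. vnorm X (vdiff X x y))"
    proof (rule field_le_mult_one_interval)
      fix t :: real assume "0 < t" "t < 1"
      then obtain x y where "x \<in> S" "y \<in> S" "2 * t \<le> vnorm X (vdiff X x y)"
        using ge[of "1 - t"] by auto
      then show "t * 2 \<le> (SUP (x, y)\<in>S \<times> S. vnorm X (vdiff X x y))"
        using cSUP_upper[OF _ bdd, of "(x, y)"] by auto
    qed
  qed
  then show "vdiameter X S = 2" using ne by (simp add: vdiameter_def)
qed

section \<open>Ultrapowers\<close>

lemma linf_space_sel [simp]:
  "vcarrier (linf_space X) = {g. (\<forall>n. g n \<in> vcarrier X) \<and> bdd_above (range (\<lambda>n. vnorm X (g n)))}"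
  "vzero (linf_space X) = (\<lambda>n. vzero X)"
  "vadd (linf_space X) g h = (\<lambda>n. vadd X (g n) (h n))"
  "vscale (linf_space X) c g = (\<lambda>n. vscale X c (g n))"
  "vnorm (linf_space X) g = (SUP n. vnorm X (g n))"
  by (simp_all add: linf_space_def)

lemma lincomb_linf_space: "lincomb (linf_space X) l g n = (\<lambda>m. lincomb X l (\<lambda>i. g i m) n)"
  by (induction n) auto

lemma vdiff_linf_space: "vdiff (linf_space X) g h = (\<lambda>m. vdiff X (g m) (h m))"
  by (simp add: vdiff_def)

lemma norm_linf_space_le: "(\<And>n. vnorm X (g n) \<le> b) \<Longrightarrow> vnorm (linf_space X) g \<le> b"
  by (auto intro!: cSUP_least)

lemma norm_le_linf_space: "g \<in> vcarrier (linf_space X) \<Longrightarrow> vnorm X (g n) \<le> vnorm (linf_space X) g"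
  by (auto intro!: cSUP_upper)

lemma linf_space_memI:
  "(\<And>n. g n \<in> vcarrier X) \<Longrightarrow> (\<And>n. vnorm X (g n) \<le> b) \<Longrightarrow> g \<in> vcarrier (linf_space X)"
  by (auto simp: bdd_above_def)

context seminormed
begin

lemma seminormed_linf_space: "seminormed (linf_space X)"
proof
  fix g h assume g: "g \<in> vcarrier (linf_space X)" and h: "h \<in> vcarrier (linf_space X)"
  have le: "vnorm X (vadd (linf_space X) g h n) \<le> vnorm (linf_space X) g + vnorm (linf_space X) h" for n
    using norm_add[of "g n" "h n"] norm_le_linf_space[OF g, of n] norm_le_linf_space[OF h, of n] g h
    by simp
  then show "vnorm (linf_space X) (vadd (linf_space X) g h) \<le> vnorm (linf_space X) g + vnorm (linf_space X) h"
    by (rule norm_linf_space_le)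
  show "vadd (linf_space X) g h \<in> vcarrier (linf_space X)"
    using le by (rule linf_space_memI[rotated]) (use g h in auto)
next
  fix g c assume g: "g \<in> vcarrier (linf_space X)"
  have le: "vnorm X (vscale (linf_space X) c g n) \<le> \<bar>c\<bar> * vnorm (linf_space X) g" for n
    using norm_scale_le[of "g n" c] mult_left_mono[OF norm_le_linf_space[OF g, of n], of "\<bar>c\<bar>"] g
    by simp
  then show "vnorm (linf_space X) (vscale (linf_space X) c g) \<le> \<bar>c\<bar> * vnorm (linf_space X) g"
    by (rule norm_linf_space_le)
  show "vscale (linf_space X) c g \<in> vcarrier (linf_space X)"
    using le by (rule linf_space_memI[rotated]) (use g in auto)
next
  show "vzero (linf_space X) \<in> vcarrier (linf_space X)" by (auto simp: bdd_above_def)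
qed (auto simp: add_assoc scale_add add_scale scale_scale fun_eq_iff intro: add_commute)

end

section \<open>Quotients of seminormed spaces by subspaces\<close>

locale seminormed_quotient = seminormed X for X :: "'v nspace" +
  fixes N :: "'v set"
  assumes N_closed: "z \<in> N \<Longrightarrow> z \<in> vcarrier X"
    and N_zero: "vzero X \<in> N"
    and N_add: "\<lbrakk>z \<in> N; w \<in> N\<rbrakk> \<Longrightarrow> vadd X z w \<in> N"
    and N_scale: "z \<in> N \<Longrightarrow> vscale X c z \<in> N"
begin

abbreviation "Q \<equiv> quotient_nspace X N"
abbreviation "cls \<equiv> vcoset X N"

lemma cls_self: "x \<in> vcarrier X \<Longrightarrow> x \<in> cls x"
  using N_zero by (force simp: vcoset_def)

lemma cls_closed: "\<lbrakk>x \<in> vcarrier X; a \<in> cls x\<rbrakk> \<Longrightarrow> a \<in> vcarrier X"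
  using N_closed by (auto simp: vcoset_def)

lemma cls_subset:
  assumes "x \<in> vcarrier X" "z \<in> N"
  shows "cls (vadd X x z) \<subseteq> cls x"
proof
  fix a assume "a \<in> cls (vadd X x z)"
  then obtain w where "w \<in> N" "a = vadd X (vadd X x z) w" by (auto simp: vcoset_def)
  then have "a = vadd X x (vadd X z w)" "vadd X z w \<in> N"
    using assms N_closed N_add by (auto simp: add_assoc)
  then show "a \<in> cls x" by (auto simp: vcoset_def)
qed

lemma cls_eq:
  assumes x: "x \<in> vcarrier X" and a: "a \<in> cls x"
  shows "cls a = cls x"
proof -
  obtain z where z: "z \<in> N" "a = vadd X x z" using a by (auto simp: vcoset_def)
  have "vadd X a (vscale X (-1) z) = vadd X x (vdiff X z z)"
    using x z N_closed by (simp add: vdiff_def add_assoc)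
  then have "vadd X a (vscale X (-1) z) = x" using x z N_closed by simp
  then have "cls x \<subseteq> cls a"
    using cls_subset[of a "vscale X (-1) z"] cls_closed[OF x a] N_scale[OF z(1)] by simp
  then show ?thesis using cls_subset[OF x z(1)] z(2) by auto
qed

lemma cls_quotient_carrier [simp]: "x \<in> vcarrier X \<Longrightarrow> cls x \<in> vcarrier Q"
  by (simp add: quotient_nspace_def)

lemma quotient_carrierE:
  assumes "A \<in> vcarrier Q"
  obtains x where "x \<in> vcarrier X" "A = cls x"
  using assms by (auto simp: quotient_nspace_def)

lemma quotient_zero: "vzero Q = cls (vzero X)"
  using N_closed by (force simp: quotient_nspace_def vcoset_def)

lemma quotient_add:
  assumes x: "x \<in> vcarrier X" and y: "y \<in> vcarrier X"
  shows "vadd Q (cls x) (cls y) = cls (vadd X x y)"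
proof -
  have eq: "vadd X (vadd X x z) (vadd X y w) = vadd X (vadd X x y) (vadd X z w)"
    if "z \<in> N" "w \<in> N" for z w
    using x y that N_closed by (simp add: add_assoc add_left_commute)
  have "vadd X (vadd X x y) z \<in> {vadd X a b |a b. a \<in> cls x \<and> b \<in> cls y}" if "z \<in> N" for z
  proof -
    have "vadd X x z \<in> cls x" using that by (auto simp: vcoset_def)
    moreover have "vadd X (vadd X x y) z = vadd X (vadd X x z) y"
      using eq[OF that N_zero] that N_closed x y by simp
    ultimately show ?thesis using cls_self[OF y] by blast
  qed
  moreover have "vadd X a b \<in> cls (vadd X x y)" if "a \<in> cls x" "b \<in> cls y" for a b
    using that eq N_add by (fastforce simp: vcoset_def)
  ultimately show ?thesis
    by (auto simp: quotient_nspace_def vcoset_def[of X N "vadd X x y"])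
qed

lemma quotient_scale:
  assumes x: "x \<in> vcarrier X"
  shows "vscale Q c (cls x) = cls (vscale X c x)"
proof -
  have eq: "vadd X (vscale X c (vadd X x z)) w = vadd X (vscale X c x) (vadd X (vscale X c z) w)"
    if "z \<in> N" "w \<in> N" for z w
    using x that N_closed by (simp add: scale_add add_assoc)
  have "vadd X (vscale X c a) w \<in> cls (vscale X c x)" if "a \<in> cls x" "w \<in> N" for a w
    using that eq N_add N_scale by (fastforce simp: vcoset_def)
  moreover have "vadd X (vscale X c x) w \<in> {vadd X (vscale X c a) z |a z. a \<in> cls x \<and> z \<in> N}"
    if "w \<in> N" for w
    using that cls_self[OF x] by blast
  ultimately show ?thesis
    by (auto simp: quotient_nspace_def vcoset_def[of X N "vscale X c x"])
qed

lemma quotient_norm: "vnorm Q A = (INF a\<in>A. vnorm X a)"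
  by (simp add: quotient_nspace_def)

lemma quotient_norm_le:
  assumes "x \<in> vcarrier X" "a \<in> cls x"
  shows "vnorm Q (cls x) \<le> vnorm X a"
  unfolding quotient_norm using assms norm_nonneg cls_closed
  by (intro cINF_lower) (auto simp: bdd_below_def)

lemma quotient_norm_ge:
  assumes "x \<in> vcarrier X" "\<And>a. a \<in> cls x \<Longrightarrow> b \<le> vnorm X a"
  shows "b \<le> vnorm Q (cls x)"
  unfolding quotient_norm using assms cls_self[OF assms(1)] by (intro cINF_greatest) auto

text \<open>The infimum defining the norm of a class need not be attained, so it is a strict bound
  that passes to a representative.\<close>

lemma quotient_representative:
  assumes "A \<in> vcarrier Q" "vnorm Q A < b"
  obtains a where "a \<in> vcarrier X" "A = cls a" "vnorm X a < b"
proof -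
  obtain x where x: "x \<in> vcarrier X" "A = cls x" using assms(1) by (rule quotient_carrierE)
  with assms(2) have "\<exists>a\<in>cls x. vnorm X a < b"
    using quotient_norm_ge[OF x(1), of b] by (meson not_le)
  then obtain a where a: "a \<in> cls x" "vnorm X a < b" by blast
  show thesis
    using that[of a] a x cls_closed[OF x(1) a(1)] cls_eq[OF x(1) a(1)] by simp
qed

lemma seminormed_quotient_nspace: "seminormed Q"
proof
  fix A B assume A: "A \<in> vcarrier Q" and B: "B \<in> vcarrier Q"
  show "vnorm Q (vadd Q A B) \<le> vnorm Q A + vnorm Q B"
  proof (rule field_le_epsilon)
    fix e :: real assume "0 < e"
    obtain a where a: "a \<in> vcarrier X" "A = cls a" "vnorm X a < vnorm Q A + e / 2"
      using A \<open>0 < e\<close> by (rule_tac quotient_representative[of A "vnorm Q A + e / 2"]) auto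
    obtain b where b: "b \<in> vcarrier X" "B = cls b" "vnorm X b < vnorm Q B + e / 2"
      using B \<open>0 < e\<close> by (rule_tac quotient_representative[of B "vnorm Q B + e / 2"]) auto
    have "vnorm Q (vadd Q A B) \<le> vnorm X (vadd X a b)"
      using a b by (auto simp: quotient_add intro!: quotient_norm_le cls_self)
    then show "vnorm Q (vadd Q A B) \<le> vnorm Q A + vnorm Q B + e"
      using a b norm_add[of a b] by simp
  qed
  show "vadd Q A B \<in> vcarrier Q" "vadd Q A B = vadd Q B A"
    using A B by (auto elim!: quotient_carrierE simp: quotient_add add_commute)
  show "vscale Q c (vadd Q A B) = vadd Q (vscale Q c A) (vscale Q c B)" for c
    using A B by (auto elim!: quotient_carrierE simp: quotient_add quotient_scale scale_add)
  show "vadd Q (vadd Q A B) D = vadd Q A (vadd Q B D)" if "D \<in> vcarrier Q" for D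
    using A B that by (auto elim!: quotient_carrierE simp: quotient_add add_assoc)
next
  fix A c assume A: "A \<in> vcarrier Q"
  obtain x where x: "x \<in> vcarrier X" "A = cls x" using A by (rule quotient_carrierE)
  show "vnorm Q (vscale Q c A) \<le> \<bar>c\<bar> * vnorm Q A"
  proof (rule field_le_epsilon)
    fix e :: real assume "0 < e"
    \<comment> \<open>The denominator \<open>\<bar>c\<bar> + 1\<close> covers \<open>c = 0\<close>
      as well.\<close>
    then obtain a where a: "a \<in> vcarrier X" "A = cls a" "vnorm X a < vnorm Q A + e / (\<bar>c\<bar> + 1)"
      using A quotient_representative[of A "vnorm Q A + e / (\<bar>c\<bar> + 1)"] by auto
    have "vnorm Q (vscale Q c A) \<le> vnorm X (vscale X c a)"
      using a by (auto simp: quotient_scale intro!: quotient_norm_le cls_self)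
    also have "\<dots> \<le> \<bar>c\<bar> * vnorm X a" using a by (simp add: norm_scale_le)
    also have "\<dots> \<le> \<bar>c\<bar> * (vnorm Q A + e / (\<bar>c\<bar> + 1))"
      using a by (intro mult_left_mono) auto
    also have "\<dots> \<le> \<bar>c\<bar> * vnorm Q A + e"
      using \<open>0 < e\<close> by (auto simp: field_simps)
    finally show "vnorm Q (vscale Q c A) \<le> \<bar>c\<bar> * vnorm Q A + e" .
  qed
  show "vscale Q c A \<in> vcarrier Q" "vadd Q A (vzero Q) = A" "vscale Q 1 A = A"
    "vscale Q 0 A = vzero Q"
    using x by (auto simp: quotient_scale quotient_zero quotient_add)
  show "vscale Q (a + b) A = vadd Q (vscale Q a A) (vscale Q b A)"
    "vscale Q a (vscale Q b A) = vscale Q (a * b) A" for a b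
    using x by (auto simp: quotient_scale quotient_add add_scale scale_scale)
qed (simp add: quotient_zero)

lemma quotient_lincomb:
  "(\<And>i. i < n \<Longrightarrow> x i \<in> vcarrier X)
    \<Longrightarrow> lincomb Q l (\<lambda>i. cls (x i)) n = cls (lincomb X l x n)"
  by (induction n) (auto simp: quotient_zero quotient_scale quotient_add lincomb_closed)

lemma quotient_diff:
  "\<lbrakk>x \<in> vcarrier X; y \<in> vcarrier X\<rbrakk> \<Longrightarrow> vdiff Q (cls x) (cls y) = cls (vdiff X x y)"
  by (simp add: vdiff_def quotient_scale quotient_add)

end

section \<open>Ultrapowers as quotients by null sequences, and the transfer of spreadability\<close>

abbreviation null_seqs :: "'v nspace \<Rightarrow> nat filter \<Rightarrow> (nat \<Rightarrow> 'v) set" where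
  "null_seqs X U \<equiv> {g \<in> vcarrier (linf_space X). ((\<lambda>n. vnorm X (g n)) \<longlongrightarrow> 0) U}"

lemma (in seminormed) seminormed_quotient_null_seqs:
  "seminormed_quotient (linf_space X) (null_seqs X U)"
proof (intro_locales)
  show "seminormed (linf_space X)" by (rule seminormed_linf_space)
  then interpret L: seminormed "linf_space X" .
  show "seminormed_quotient_axioms (linf_space X) (null_seqs X U)"
  proof
    show "vzero (linf_space X) \<in> null_seqs X U" using L.zero_closed by (simp add: norm_zero)
  next
    fix z w assume z: "z \<in> null_seqs X U" and w: "w \<in> null_seqs X U"
    have "((\<lambda>n. vnorm X (z n) + vnorm X (w n)) \<longlongrightarrow> 0 + 0) U"
      using z w by (intro tendsto_add) auto
    moreover have "norm (vnorm X (vadd X (z n) (w n))) \<le> vnorm X (z n) + vnorm X (w n)" for n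
      using z w by (simp add: norm_nonneg norm_add)
    ultimately have "((\<lambda>n. vnorm X (vadd X (z n) (w n))) \<longlongrightarrow> 0) U"
      using Lim_null_comparison[OF always_eventually] by fastforce
    then show "vadd (linf_space X) z w \<in> null_seqs X U"
      using L.add_closed[of z w] z w by simp
  next
    fix z c assume z: "z \<in> null_seqs X U"
    have "((\<lambda>n. \<bar>c\<bar> * vnorm X (z n)) \<longlongrightarrow> \<bar>c\<bar> * 0) U"
      using z by (intro tendsto_mult_left) auto
    moreover have "norm (vnorm X (vscale X c (z n))) \<le> \<bar>c\<bar> * vnorm X (z n)" for n
      using z by (simp add: norm_nonneg norm_scale_le)
    ultimately have "((\<lambda>n. vnorm X (vscale X c (z n))) \<longlongrightarrow> 0) U"
      using Lim_null_comparison[OF always_eventually] by fastforce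
    then show "vscale (linf_space X) c z \<in> null_seqs X U"
      using L.scale_closed[of z c] z by simp
  qed auto
qed

text \<open>Representatives of the given classes are spread in each coordinate separately. All
  bounds are independent of the coordinate, so the results form bounded sequences whose classes
  satisfy the same estimates.\<close>

theorem (in seminormed) spreadable_ultrapower:
  assumes spr: "spreadable X C" and U: "U \<noteq> bot"
  shows "spreadable (ultrapower X U) C"
proof -
  interpret L: seminormed_quotient "linf_space X" "null_seqs X U"
    by (rule seminormed_quotient_null_seqs)
  \<comment> \<open>A lower bound valid in every coordinate survives the quotient: any
    representative \<open>a\<close> differs from \<open>v\<close> by a null sequence
    \<open>z\<close>, so its norm is at least \<open>b - vnorm X (z m)\<close> for every
    \<open>m\<close>, and the limit along \<open>U\<close> is \<open>b\<close>.\<close>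
  have ge: "b \<le> vnorm L.Q (L.cls v)"
    if v: "v \<in> vcarrier (linf_space X)" and b: "\<And>m. b \<le> vnorm X (v m)" for v b
  proof (rule L.quotient_norm_ge[OF v])
    fix a assume "a \<in> L.cls v"
    then obtain z where z: "z \<in> null_seqs X U" "a = vadd (linf_space X) v z"
      by (auto simp: vcoset_def)
    have a: "a \<in> vcarrier (linf_space X)" using z v L.add_closed[of v z] by simp
    have "b - vnorm X (z m) \<le> vnorm (linf_space X) a" for m
    proof -
      have "v m = vdiff X (a m) (z m)"
        using z v diff_self[of "z m"] by (simp add: vdiff_def add_assoc)
      then have "vnorm X (v m) \<le> vnorm X (a m) + vnorm X (z m)"
        using a z norm_diff_le[of "a m" "z m"] by simp
      then show ?thesis using b[of m] norm_le_linf_space[OF a, of m] by linarith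
    qed
    moreover have "((\<lambda>m. b - vnorm X (z m)) \<longlongrightarrow> b - 0) U"
      using z by (intro tendsto_intros) auto
    ultimately show "b \<le> vnorm (linf_space X) a"
      using tendsto_upperbound[of "\<lambda>m. b - vnorm X (z m)" b U] U by simp
  qed
  have le: "vnorm L.Q (L.cls v) \<le> b"
    if "v \<in> vcarrier (linf_space X)" "\<And>m. vnorm X (v m) \<le> b" for v b
    by (rule order_trans[OF L.quotient_norm_le[OF that(1) L.cls_self[OF that(1)]]
      norm_linf_space_le[OF that(2)]])
  have "spreadable L.Q C"
    unfolding spreadable_def
  proof (intro allI impI)
    fix K n :: nat and \<epsilon> :: real and F
    assume F: "0 < \<epsilon> \<and> \<epsilon> < 1 \<and> (\<forall>i<n. F i \<in> vcarrier L.Q \<and> vnorm L.Q (F i) \<le> 1 - \<epsilon>)"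
    \<comment> \<open>A class of norm at most \<open>1 - \<epsilon>\<close> is only sure to have
      representatives of norm below \<open>1 - \<epsilon> / 2\<close>. The coordinates are therefore
      spread with \<open>\<epsilon> / 2\<close>, which makes the lower bound on distances larger
      than required.\<close>
    define P where "P i f \<longleftrightarrow> f \<in> vcarrier (linf_space X) \<and> F i = L.cls f \<and>
      vnorm (linf_space X) f < 1 - \<epsilon> / 2" for i f
    have "\<exists>f. P i f" if "i < n" for i
    proof -
      have "F i \<in> vcarrier L.Q" "vnorm L.Q (F i) < 1 - \<epsilon> / 2" using F that by fastforce+
      then show ?thesis unfolding P_def by (rule L.quotient_representative) blast
    qed
    then obtain f where "\<And>i. i < n \<Longrightarrow> P i (f i)" by metis
    then have f: "f i \<in> vcarrier (linf_space X)" "F i = L.cls (f i)"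
      "vnorm (linf_space X) (f i) < 1 - \<epsilon> / 2" if "i < n" for i
      using that unfolding P_def by blast+
    have "\<exists>G. spreads X C K n (\<epsilon> / 2) (\<lambda>i. f i m) G" for m
    proof -
      have "f i m \<in> vcarrier X \<and> vnorm X (f i m) \<le> 1 - \<epsilon> / 2" if "i < n" for i
        using f(1)[OF that] f(3)[OF that] norm_le_linf_space[OF f(1)[OF that], of m] by auto
      with F have "0 < \<epsilon> / 2 \<and> \<epsilon> / 2 < 1 \<and> (\<forall>i<n. f i m \<in> vcarrier X \<and> vnorm X (f i m) \<le> 1 - \<epsilon> / 2)"
        by simp
      then show ?thesis by (rule spr[unfolded spreadable_def, rule_format])
    qed
    then obtain G where spreads: "\<And>m. spreads X C K n (\<epsilon> / 2) (\<lambda>i. f i m) (G m)" by metis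
    note G = spreadsD(1)[OF spreads] and GC = spreadsD(2)[OF spreads] and Gl = spreadsD(3)[OF spreads]
    define g where "g \<sigma> k i = (\<lambda>m. G m \<sigma> k i)" for \<sigma> k i
    have g: "g \<sigma> k i \<in> vcarrier (linf_space X)" if "k < K" "i < n" for \<sigma> k i
      using G[OF that] by (intro linf_space_memI[of _ _ 1]) (auto simp: g_def unit_ball_def)
    have "spreads L.Q C K n \<epsilon> F (\<lambda>\<sigma> k i. L.cls (g \<sigma> k i))"
      unfolding spreads_def
    proof (intro conjI allI impI)
      fix \<sigma> k i assume ki: "k < K" "i < n"
      show "L.cls (g \<sigma> k i) \<in> unit_ball L.Q"
        unfolding unit_ball_def
      proof (intro CollectI conjI L.cls_quotient_carrier g ki)
        show "vnorm L.Q (L.cls (g \<sigma> k i)) \<le> 1"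
          using G[OF ki] by (intro le g ki) (simp add: g_def unit_ball_def)
      qed
    next
      fix \<sigma> i and \<theta> :: "nat \<Rightarrow> real" assume i: "i < n" and \<theta>: "\<forall>k<K. \<bar>\<theta> k\<bar> \<le> 1"
      let ?w = "\<lambda>k. vdiff (linf_space X) (g \<sigma> k i) (f i)"
      have w: "?w k \<in> vcarrier (linf_space X)" if "k < K" for k
        using g[OF that i] f(1)[OF i] by (rule L.diff_closed)
      have "lincomb L.Q \<theta> (\<lambda>k. vdiff L.Q (L.cls (g \<sigma> k i)) (F i)) K = lincomb L.Q \<theta> (\<lambda>k. L.cls (?w k)) K"
        using g i f by (intro lincomb_cong) (simp add: L.quotient_diff del: linf_space_sel)
      also have "\<dots> = L.cls (lincomb (linf_space X) \<theta> ?w K)"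
        by (rule L.quotient_lincomb[OF w])
      also have "vnorm L.Q \<dots> \<le> C"
        using GC[OF i] \<theta>
        by (intro le L.lincomb_closed w) (auto simp: lincomb_linf_space vdiff_linf_space g_def)
      finally show "vnorm L.Q (lincomb L.Q \<theta> (\<lambda>k. vdiff L.Q (L.cls (g \<sigma> k i)) (F i)) K) \<le> C" .
    next
      fix k and l :: "nat \<Rightarrow> real" assume k: "k < K" and l: "(\<forall>i<n. 0 \<le> l i) \<and> (\<Sum>i<n. l i) = 1"
      let ?v = "vdiff (linf_space X) (lincomb (linf_space X) l (g True k) n) (lincomb (linf_space X) l (g False k) n)"
      have "2 * (1 - \<epsilon>) \<le> 2 * (1 - \<epsilon> / 2)" using F by simp
      also have "\<dots> \<le> vnorm L.Q (L.cls ?v)"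
        using Gl[OF k, of l] l g[OF k]
        by (intro ge L.diff_closed L.lincomb_closed)
          (auto simp: lincomb_linf_space vdiff_linf_space g_def)
      also have "L.cls ?v = vdiff L.Q (lincomb L.Q l (\<lambda>i. L.cls (g True k i)) n)
          (lincomb L.Q l (\<lambda>i. L.cls (g False k i)) n)"
        using g[OF k] L.lincomb_closed[of n "g _ k" l]
        by (simp add: L.quotient_lincomb L.quotient_diff del: linf_space_sel)
      finally show "2 * (1 - \<epsilon>) \<le> vnorm L.Q (vdiff L.Q (lincomb L.Q l (\<lambda>i. L.cls (g True k i)) n)
          (lincomb L.Q l (\<lambda>i. L.cls (g False k i)) n))" .
    qed
    then show "\<exists>G. spreads L.Q C K n \<epsilon> F G" by (rule exI[of "spreads L.Q C K n \<epsilon> F"])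
  qed
  then show ?thesis by (simp add: ultrapower_def)
qed

lemma (in seminormed) spreadable_imp_USD2P:
  assumes "spreadable X C"
  shows "USD2P X"
  unfolding USD2P_def
proof (intro allI impI)
  fix U :: "nat filter" assume "free_ultrafilter U"
  then have U: "U \<noteq> bot" by (simp add: free_ultrafilter_def)
  interpret L: seminormed_quotient "linf_space X" "null_seqs X U"
    by (rule seminormed_quotient_null_seqs)
  interpret Q: seminormed "ultrapower X U"
    using L.seminormed_quotient_nspace by (simp add: ultrapower_def)
  show "SD2P (ultrapower X U)"
    using spreadable_ultrapower[OF assms U] by (rule Q.spreadable_imp_SD2P)
qed

section \<open>Spaces of Lipschitz functions\<close>

lemma Lip0_sel [simp]:
  "vcarrier (Lip0 p) = {f. (\<exists>L. L-lipschitz_on UNIV f) \<and> f p = 0}"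
  "vzero (Lip0 p) = (\<lambda>x. 0)"
  "vadd (Lip0 p) f g = (\<lambda>x. f x + g x)"
  "vscale (Lip0 p) c f = (\<lambda>x. c * f x)"
  by (simp_all add: Lip0_def)

lemma lincomb_Lip0: "lincomb (Lip0 p) l f n = (\<lambda>x. \<Sum>i<n. l i * f i x)"
  by (induction n) auto

lemma vdiff_Lip0: "vdiff (Lip0 p) f g = (\<lambda>x. f x - g x)"
  by (simp add: vdiff_def)

text \<open>Exchanging \<open>x\<close> and \<open>y\<close> bounds the absolute value, so one-sided
  estimates suffice.\<close>

lemma lipschitz_on_realI:
  fixes f :: "'a::metric_space \<Rightarrow> real"
  assumes "\<And>x y. f x - f y \<le> L * dist x y" "0 \<le> L"
  shows "L-lipschitz_on UNIV f"
proof (rule lipschitz_onI)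
  show "dist (f x) (f y) \<le> L * dist x y" for x y
    using assms(1)[of x y] assms(1)[of y x] by (simp add: dist_real_def abs_le_iff dist_commute)
qed fact

lemma slope_le_norm_Lip0:
  fixes f :: "'a::metric_space \<Rightarrow> real"
  assumes f: "f \<in> vcarrier (Lip0 p)" and "x \<noteq> y"
  shows "(f x - f y) / dist x y \<le> vnorm (Lip0 p) f"
proof -
  obtain L where L: "L-lipschitz_on UNIV f" using f by auto
  have "(f u - f v) / dist u v \<le> L" if "u \<noteq> v" for u v
    using lipschitz_onD[OF L, of u v] that by (simp add: dist_real_def divide_le_eq)
  then have "bdd_above {(f x - f y) / dist x y |x y. x \<noteq> y}" by (auto simp: bdd_above_def)
  then have "(f x - f y) / dist x y \<le> Sup {(f x - f y) / dist x y |x y. x \<noteq> y}"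
    using \<open>x \<noteq> y\<close> by (intro cSup_upper) auto
  moreover have "UNIV \<noteq> {p}" using \<open>x \<noteq> y\<close> by (metis UNIV_I singletonD)
  ultimately show ?thesis by (simp add: Lip0_def)
qed

text \<open>The two slopes between \<open>x\<close> and \<open>p\<close>, taken in either order, are
  opposite numbers, and both are bounded by the norm.\<close>

lemma norm_Lip0_nonneg:
  fixes f :: "'a::metric_space \<Rightarrow> real"
  assumes "f \<in> vcarrier (Lip0 p)"
  shows "0 \<le> vnorm (Lip0 p) f"
proof (cases "UNIV = {p}")
  case False
  then obtain x where "x \<noteq> p" by blast
  then show ?thesis
    using slope_le_norm_Lip0[OF assms, of x p] slope_le_norm_Lip0[OF assms, of p x] assms
    by (auto simp: dist_commute)
qed (simp add: Lip0_def)

text \<open>This turns norm estimates in \<open>Lip0 p\<close> into statements about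
  \<open>lipschitz_on\<close>. The sign condition on \<open>L\<close> settles the one-point space,
  whose norm is 0 by convention.\<close>

lemma norm_Lip0_le_iff:
  fixes f :: "'a::metric_space \<Rightarrow> real"
  assumes "f p = 0" and "0 \<le> L"
  shows "f \<in> vcarrier (Lip0 p) \<and> vnorm (Lip0 p) f \<le> L \<longleftrightarrow> L-lipschitz_on UNIV f"
proof
  assume f: "f \<in> vcarrier (Lip0 p) \<and> vnorm (Lip0 p) f \<le> L"
  have "f x - f y \<le> L * dist x y" for x y
  proof (cases "x = y")
    case False
    then have "(f x - f y) / dist x y \<le> L" using f slope_le_norm_Lip0[of f p x y] by auto
    then show ?thesis using False by (simp add: divide_le_eq)
  qed simp
  then show "L-lipschitz_on UNIV f" using \<open>0 \<le> L\<close> by (rule lipschitz_on_realI)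
next
  assume L: "L-lipschitz_on UNIV f"
  have "vnorm (Lip0 p) f \<le> L"
  proof (cases "UNIV = {p}")
    case False
    then obtain x where "x \<noteq> p" by blast
    have "(f u - f v) / dist u v \<le> L" if "u \<noteq> v" for u v
      using lipschitz_onD[OF L, of u v] that by (simp add: dist_real_def divide_le_eq)
    then have "Sup {(f x - f y) / dist x y |x y. x \<noteq> y} \<le> L"
      using \<open>x \<noteq> p\<close> by (intro cSup_least) auto
    then show ?thesis using False by (simp add: Lip0_def)
  qed (use \<open>0 \<le> L\<close> in \<open>simp add: Lip0_def\<close>)
  then show "f \<in> vcarrier (Lip0 p) \<and> vnorm (Lip0 p) f \<le> L" using L \<open>f p = 0\<close> by auto
qed

lemma lipschitz_norm_Lip0:
  "f \<in> vcarrier (Lip0 p) \<Longrightarrow> (vnorm (Lip0 p) f)-lipschitz_on UNIV f"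
  using norm_Lip0_le_iff[of f p "vnorm (Lip0 p) f"] norm_Lip0_nonneg[of f p] by auto

lemma seminormed_Lip0: "seminormed (Lip0 p)"
proof
  fix f g assume f: "f \<in> vcarrier (Lip0 p)" and g: "g \<in> vcarrier (Lip0 p)"
  have "(vnorm (Lip0 p) f + vnorm (Lip0 p) g)-lipschitz_on UNIV (\<lambda>x. f x + g x)"
    by (intro lipschitz_on_add lipschitz_norm_Lip0 f g)
  then have "vadd (Lip0 p) f g \<in> vcarrier (Lip0 p) \<and>
      vnorm (Lip0 p) (vadd (Lip0 p) f g) \<le> vnorm (Lip0 p) f + vnorm (Lip0 p) g"
    using norm_Lip0_nonneg[OF f] norm_Lip0_nonneg[OF g] f g
    by (subst norm_Lip0_le_iff) auto
  then show "vadd (Lip0 p) f g \<in> vcarrier (Lip0 p)"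
    "vnorm (Lip0 p) (vadd (Lip0 p) f g) \<le> vnorm (Lip0 p) f + vnorm (Lip0 p) g" by blast+
next
  fix f c assume f: "f \<in> vcarrier (Lip0 p)"
  have "(\<bar>c\<bar> * vnorm (Lip0 p) f)-lipschitz_on UNIV (\<lambda>x. c * f x)"
    by (intro lipschitz_on_cmult_real lipschitz_norm_Lip0 f)
  then have "vscale (Lip0 p) c f \<in> vcarrier (Lip0 p) \<and>
      vnorm (Lip0 p) (vscale (Lip0 p) c f) \<le> \<bar>c\<bar> * vnorm (Lip0 p) f"
    using norm_Lip0_nonneg[OF f] f by (subst norm_Lip0_le_iff) auto
  then show "vscale (Lip0 p) c f \<in> vcarrier (Lip0 p)"
    "vnorm (Lip0 p) (vscale (Lip0 p) c f) \<le> \<bar>c\<bar> * vnorm (Lip0 p) f" by blast+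
next
  show "vzero (Lip0 p) \<in> vcarrier (Lip0 p)" by (auto intro: lipschitz_on_constant)
qed (auto simp: algebra_simps)

section \<open>Changing a Lipschitz function inside an annulus\<close>

definition annulus :: "real \<Rightarrow> 'a::metric_space \<Rightarrow> real \<Rightarrow> 'a set" where
  "annulus r c D = {x. r * D < dist x c \<and> r * dist x c < D}"

text \<open>The second argument of the maximum is a downward cone of slope 1 with apex over
  \<open>t\<close>, of the height that makes the slope between \<open>t\<close> and \<open>s\<close>
  equal to \<open>1 - \<epsilon>\<close>.\<close>

definition bump :: "real \<Rightarrow> 'a::metric_space \<Rightarrow> 'a \<Rightarrow> ('a \<Rightarrow> real) \<Rightarrow> 'a \<Rightarrow> real" where
  "bump \<epsilon> t s f x = max (f x) (f s + (1 - \<epsilon>) * dist t s - dist x t)"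

text \<open>A maximum of 1-Lipschitz functions is 1-Lipschitz; the cone wins at \<open>t\<close> and
  loses at \<open>s\<close>. Off the annulus one of \<open>dist x s\<close> and
  \<open>dist t s\<close> is at most \<open>\<epsilon> / 2\<close> times the other, so
  \<open>dist x t\<close> is nearly their sum and the cone has dropped below
  \<open>f\<close>.\<close>

lemma
  fixes f :: "'a::metric_space \<Rightarrow> real"
  assumes f: "(1 - \<epsilon>)-lipschitz_on UNIV f" and \<epsilon>: "0 < \<epsilon>"
  shows lipschitz_bump: "1-lipschitz_on UNIV (bump \<epsilon> t s f)"
    and bump_slope: "bump \<epsilon> t s f t - bump \<epsilon> t s f s = (1 - \<epsilon>) * dist t s"
    and bump_outside: "x \<notin> annulus (\<epsilon> / 2) s (dist t s) \<Longrightarrow> bump \<epsilon> t s f x = f x"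
proof -
  have \<epsilon>1: "\<epsilon> \<le> 1" using lipschitz_on_nonneg[OF f] by simp
  have lip: "f x - f y \<le> (1 - \<epsilon>) * dist x y" for x y
    using lipschitz_onD[OF f, of x y] by (simp add: dist_real_def)
  have "bump \<epsilon> t s f x - bump \<epsilon> t s f y \<le> dist x y" for x y
  proof -
    have "(1 - \<epsilon>) * dist x y \<le> 1 * dist x y" using \<epsilon> by (intro mult_right_mono) auto
    then have "f x - f y \<le> dist x y" using lip[of x y] by linarith
    moreover have "dist y t \<le> dist x y + dist x t" by (metis dist_commute dist_triangle)
    ultimately show ?thesis unfolding bump_def by linarith
  qed
  then show "1-lipschitz_on UNIV (bump \<epsilon> t s f)" by (intro lipschitz_on_realI) auto
  have "bump \<epsilon> t s f t = f s + (1 - \<epsilon>) * dist t s"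
    using lip[of t s] by (simp add: bump_def)
  moreover have "bump \<epsilon> t s f s = f s"
    using \<epsilon> by (simp add: bump_def dist_commute mult_le_cancel_right1 left_diff_distrib)
  ultimately show "bump \<epsilon> t s f t - bump \<epsilon> t s f s = (1 - \<epsilon>) * dist t s" by simp
  show "bump \<epsilon> t s f x = f x" if "x \<notin> annulus (\<epsilon> / 2) s (dist t s)"
  proof -
    \<comment> \<open>This suffices: \<open>f s - f x\<close> is at most
      \<open>(1 - \<epsilon>) * dist s x\<close>, so the cone is then at most \<open>f x\<close> at
      the point \<open>x\<close>.\<close>
    have "(1 - \<epsilon>) * (dist s x + dist t s) \<le> dist x t"
    proof -
      from that consider "dist x s \<le> \<epsilon> / 2 * dist t s" | "dist t s \<le> \<epsilon> / 2 * dist x s"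
        unfolding annulus_def by (auto simp: not_less)
      then show ?thesis
      proof cases
        case 1
        have "(1 - \<epsilon>) * (dist s x + dist t s) \<le> (1 - \<epsilon>) * (\<epsilon> / 2 * dist t s + dist t s)"
          using 1 \<epsilon>1 by (intro mult_left_mono) (auto simp: dist_commute)
        also have "\<dots> = (1 - \<epsilon> / 2) * dist t s - \<epsilon>\<^sup>2 / 2 * dist t s"
          by (simp add: field_simps power2_eq_square)
        also have "\<dots> \<le> (1 - \<epsilon> / 2) * dist t s" by simp
        also have "\<dots> \<le> dist t s - dist x s"
          using 1 by (simp add: algebra_simps)
        also have "\<dots> \<le> dist x t" using dist_triangle[of t s x] by (simp add: dist_commute)
        finally show ?thesis .
      next
        case 2
        have "(1 - \<epsilon>) * (dist s x + dist t s) \<le> (1 - \<epsilon>) * (dist s x + \<epsilon> / 2 * dist s x)"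
          using 2 \<epsilon>1 by (intro mult_left_mono) (auto simp: dist_commute)
        also have "\<dots> = (1 - \<epsilon> / 2) * dist s x - \<epsilon>\<^sup>2 / 2 * dist s x"
          by (simp add: field_simps power2_eq_square)
        also have "\<dots> \<le> (1 - \<epsilon> / 2) * dist s x" by simp
        also have "\<dots> \<le> dist s x - dist t s"
          using 2 by (simp add: algebra_simps dist_commute)
        also have "\<dots> \<le> dist x t" using dist_triangle[of s x t] by (simp add: dist_commute)
        finally show ?thesis .
      qed
    qed
    then show ?thesis using lip[of s x] by (simp add: bump_def distrib_left)
  qed
qed

text \<open>A point lies in at most one of the sets \<open>A k\<close>. Between two points at most
  two summands differ, each by at most \<open>L\<close> times the distance.\<close>

lemma lipschitz_sum_disjoint_supports:
  fixes u :: "nat \<Rightarrow> 'a::metric_space \<Rightarrow> real"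
  assumes u: "\<And>k. k < K \<Longrightarrow> L-lipschitz_on UNIV (u k)" and L: "0 \<le> L"
    and supp: "\<And>k x. \<lbrakk>k < K; x \<notin> A k\<rbrakk> \<Longrightarrow> u k x = 0"
    and disj: "\<And>j k. \<lbrakk>j < K; k < K; j \<noteq> k\<rbrakk> \<Longrightarrow> A j \<inter> A k = {}"
    and \<theta>: "\<And>k. k < K \<Longrightarrow> \<bar>\<theta> k\<bar> \<le> 1"
  shows "(2 * L)-lipschitz_on UNIV (\<lambda>x. \<Sum>k<K. \<theta> k * u k x)"
proof (rule lipschitz_onI)
  fix x y :: 'a
  \<comment> \<open>\<open>?c z k\<close> charges the change of the summand \<open>k\<close> to an
    endpoint \<open>z\<close> in its support.\<close>
  let ?c = "\<lambda>z k. if z \<in> A k then L * dist x y else 0"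
  have c: "(\<Sum>k<K. ?c z k) \<le> L * dist x y" for z
  proof -
    have "card {k \<in> {..<K}. z \<in> A k} \<le> Suc 0"
      using disj by (subst card_le_Suc0_iff_eq) auto
    then have "real (card {k \<in> {..<K}. z \<in> A k}) * (L * dist x y) \<le> 1 * (L * dist x y)"
      using L by (intro mult_right_mono) auto
    then show ?thesis by (simp flip: sum.inter_filter)
  qed
  have "\<bar>\<theta> k * (u k x - u k y)\<bar> \<le> ?c x k + ?c y k" if "k < K" for k
  proof -
    have "\<bar>u k x - u k y\<bar> \<le> L * dist x y"
      using lipschitz_onD[OF u[OF that], of x y] by (simp add: dist_real_def)
    then have "\<bar>u k x - u k y\<bar> \<le> ?c x k + ?c y k"
      using supp[OF that, of x] supp[OF that, of y] L by auto
    moreover have "\<bar>\<theta> k * (u k x - u k y)\<bar> \<le> 1 * \<bar>u k x - u k y\<bar>"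
      unfolding abs_mult using \<theta>[OF that] by (intro mult_right_mono) auto
    ultimately show ?thesis by simp
  qed
  then have "\<bar>\<Sum>k<K. \<theta> k * (u k x - u k y)\<bar> \<le> (\<Sum>k<K. ?c x k + ?c y k)"
    by (intro order_trans[OF sum_abs sum_mono]) auto
  also have "\<dots> \<le> 2 * L * dist x y"
    using c[of x] c[of y] by (simp add: sum.distrib)
  finally show "dist (\<Sum>k<K. \<theta> k * u k x) (\<Sum>k<K. \<theta> k * u k y) \<le> 2 * L * dist x y"
    by (simp add: dist_real_def sum_subtractf right_diff_distrib)
qed (use L in simp)

definition scattered_pairs :: "real \<Rightarrow> nat \<Rightarrow> (nat \<Rightarrow> 'a::metric_space) \<Rightarrow> (nat \<Rightarrow> 'a) \<Rightarrow> bool" where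
  "scattered_pairs r K t s \<longleftrightarrow> (\<forall>k<K. t k \<noteq> s k) \<and>
    (\<forall>j<K. \<forall>k<K. j \<noteq> k \<longrightarrow>
      annulus r (s j) (dist (t j) (s j)) \<inter> annulus r (s k) (dist (t k) (s k)) = {})"

text \<open>Each change is 2-Lipschitz as a difference of two 1-Lipschitz functions, and summing
  over disjoint supports at most doubles the constant; hence 4. For fixed \<open>k\<close> all the
  \<open>f i\<close> are changed along the same pair, so the prescribed slopes persist in convex
  combinations.\<close>

lemma spreadable_Lip0:
  fixes p :: "'a::metric_space"
  assumes ex: "\<And>r K. \<lbrakk>0 < r; r < 1\<rbrakk> \<Longrightarrow> \<exists>t s :: nat \<Rightarrow> 'a. scattered_pairs r K t s"
  shows "spreadable (Lip0 p) 4"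
  unfolding spreadable_def
proof (intro allI impI)
  fix K n \<epsilon> and f :: "nat \<Rightarrow> 'a \<Rightarrow> real"
  assume *: "0 < \<epsilon> \<and> \<epsilon> < 1 \<and> (\<forall>i<n. f i \<in> vcarrier (Lip0 p) \<and> vnorm (Lip0 p) (f i) \<le> 1 - \<epsilon>)"
  then have \<epsilon>: "0 < \<epsilon>" "\<epsilon> < 1" by auto
  have f: "(1 - \<epsilon>)-lipschitz_on UNIV (f i)" "f i p = 0" if "i < n" for i
    using * that norm_Lip0_le_iff[of "f i" p "1 - \<epsilon>"] by auto
  obtain t s :: "nat \<Rightarrow> 'a" where "scattered_pairs (\<epsilon> / 2) K t s"
    using ex[of "\<epsilon> / 2" K] \<epsilon> by auto
  then have ts: "\<And>k. k < K \<Longrightarrow> t k \<noteq> s k"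
    and disj: "\<And>j k. \<lbrakk>j < K; k < K; j \<noteq> k\<rbrakk> \<Longrightarrow>
      annulus (\<epsilon> / 2) (s j) (dist (t j) (s j)) \<inter> annulus (\<epsilon> / 2) (s k) (dist (t k) (s k)) = {}"
    unfolding scattered_pairs_def by blast+
  \<comment> \<open>The slope \<open>\<epsilon> - 1\<close> is obtained by bumping the negative of
    \<open>f i\<close> and negating the result.\<close>
  define sg :: "bool \<Rightarrow> real" where "sg \<sigma> = (if \<sigma> then 1 else - 1)" for \<sigma>
  have sg: "\<bar>sg \<sigma>\<bar> = 1" "sg \<sigma> * sg \<sigma> = 1" "sg \<sigma> * (sg \<sigma> * a) = a" for \<sigma> a by (auto simp: sg_def)
  define b where "b \<sigma> k i x = sg \<sigma> * bump \<epsilon> (t k) (s k) (\<lambda>x. sg \<sigma> * f i x) x" for \<sigma> k i x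
  have sf: "(1 - \<epsilon>)-lipschitz_on UNIV (\<lambda>x. sg \<sigma> * f i x)" if "i < n" for \<sigma> i
    using lipschitz_on_cmult_real[OF f(1)[OF that], of "sg \<sigma>"] by (simp add: sg)
  have b_lip: "1-lipschitz_on UNIV (b \<sigma> k i)" if "i < n" for \<sigma> k i
    using lipschitz_on_cmult_real[OF lipschitz_bump[OF sf[OF that] \<epsilon>(1)], of "sg \<sigma>"]
    unfolding b_def by (simp add: sg)
  have b_slope: "b \<sigma> k i (t k) - b \<sigma> k i (s k) = sg \<sigma> * ((1 - \<epsilon>) * dist (t k) (s k))"
    if "i < n" for \<sigma> k i
    unfolding b_def right_diff_distrib[symmetric] bump_slope[OF sf[OF that] \<epsilon>(1)] ..
  have b_out: "b \<sigma> k i x = f i x"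
    if "i < n" "x \<notin> annulus (\<epsilon> / 2) (s k) (dist (t k) (s k))" for \<sigma> k i x
    unfolding b_def bump_outside[OF sf[OF that(1)] \<epsilon>(1) that(2)] by (simp add: sg)
  \<comment> \<open>The base point may lie in the annulus. Subtracting a constant restores the value
    0 there and affects no slope.\<close>
  define G where "G \<sigma> k i x = b \<sigma> k i x - b \<sigma> k i p" for \<sigma> k i x
  have G_lip: "1-lipschitz_on UNIV (G \<sigma> k i)" if "i < n" for \<sigma> k i
    using b_lip[OF that, of \<sigma> k] by (simp add: lipschitz_on_def dist_real_def G_def)
  have G: "G \<sigma> k i \<in> unit_ball (Lip0 p)" if "i < n" for \<sigma> k i
    using G_lip[OF that, of \<sigma> k] norm_Lip0_le_iff[of "G \<sigma> k i" p 1]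
    by (auto simp: unit_ball_def G_def)
  interpret seminormed "Lip0 p" by (rule seminormed_Lip0)
  have "spreads (Lip0 p) 4 K n \<epsilon> f G"
    unfolding spreads_def
  proof (intro conjI allI impI)
    show "G \<sigma> k i \<in> unit_ball (Lip0 p)" if "i < n" for \<sigma> k i using that by (rule G)
  next
    fix \<sigma> i and \<theta> :: "nat \<Rightarrow> real" assume i: "i < n" and \<theta>: "\<forall>k<K. \<bar>\<theta> k\<bar> \<le> 1"
    have "2-lipschitz_on UNIV (\<lambda>x. b \<sigma> k i x - f i x)" for k
      using lipschitz_on_diff[OF b_lip[OF i, of \<sigma> k] f(1)[OF i]] \<epsilon>
      by (rule_tac lipschitz_on_mono) auto
    then have "(2 * 2)-lipschitz_on UNIV (\<lambda>x. \<Sum>k<K. \<theta> k * (b \<sigma> k i x - f i x))"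
      using b_out[OF i] disj \<theta>
      by (intro lipschitz_sum_disjoint_supports
        [where A = "\<lambda>k. annulus (\<epsilon> / 2) (s k) (dist (t k) (s k))"]) auto
    then have "4-lipschitz_on UNIV (\<lambda>x. (\<Sum>k<K. \<theta> k * (b \<sigma> k i x - f i x)) - (\<Sum>k<K. \<theta> k * b \<sigma> k i p))"
      by (simp add: lipschitz_on_def dist_real_def)
    also have "(\<lambda>x. (\<Sum>k<K. \<theta> k * (b \<sigma> k i x - f i x)) - (\<Sum>k<K. \<theta> k * b \<sigma> k i p)) =
        lincomb (Lip0 p) \<theta> (\<lambda>k. vdiff (Lip0 p) (G \<sigma> k i) (f i)) K"
      by (auto simp: lincomb_Lip0 vdiff_Lip0 G_def fun_eq_iff algebra_simps simp flip: sum_subtractf sum.distrib)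
    finally show "vnorm (Lip0 p) (lincomb (Lip0 p) \<theta> (\<lambda>k. vdiff (Lip0 p) (G \<sigma> k i) (f i)) K) \<le> 4"
      using f(2)[OF i] by (subst (asm) norm_Lip0_le_iff[symmetric, of _ p])
        (auto simp: lincomb_Lip0 vdiff_Lip0 G_def)
  next
    fix k and l :: "nat \<Rightarrow> real" assume k: "k < K" and l: "(\<forall>i<n. 0 \<le> l i) \<and> (\<Sum>i<n. l i) = 1"
    let ?v = "vdiff (Lip0 p) (lincomb (Lip0 p) l (G True k) n) (lincomb (Lip0 p) l (G False k) n)"
    have v: "?v \<in> vcarrier (Lip0 p)"
      using G by (intro diff_closed lincomb_closed) (auto simp: unit_ball_def)
    \<comment> \<open>The norm is bounded below by the slope between \<open>t k\<close> and
      \<open>s k\<close>, where the two combinations have the opposite slopes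
      \<open>1 - \<epsilon>\<close> and \<open>\<epsilon> - 1\<close>.\<close>
    have "?v (t k) - ?v (s k) = (\<Sum>i<n. l i * ((G True k i (t k) - G True k i (s k)) -
        (G False k i (t k) - G False k i (s k))))"
      by (simp add: lincomb_Lip0 vdiff_Lip0 right_diff_distrib sum_subtractf)
    also have "\<dots> = (\<Sum>i<n. l i * (2 * (1 - \<epsilon>) * dist (t k) (s k)))"
      using b_slope[of _ _ k] by (intro sum.cong refl) (simp add: G_def sg_def)
    also have "\<dots> = 2 * (1 - \<epsilon>) * dist (t k) (s k)"
      using l by (simp flip: sum_distrib_right)
    finally have "(?v (t k) - ?v (s k)) / dist (t k) (s k) = 2 * (1 - \<epsilon>)"
      using ts[OF k] by simp
    then show "2 * (1 - \<epsilon>) \<le> vnorm (Lip0 p) ?v"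
      using slope_le_norm_Lip0[OF v ts[OF k]] by simp
  qed
  then show "\<exists>G. spreads (Lip0 p) 4 K n \<epsilon> f G"
    by (rule exI[of "spreads (Lip0 p) 4 K n \<epsilon> f"])
qed

section \<open>Scattered pairs of points\<close>

text \<open>The outer radius \<open>D' / r\<close> of one annulus is at most the inner radius
  \<open>r * D\<close> of the other.\<close>

lemma annulus_disjoint_concentric:
  assumes "0 < r" "D' \<le> r\<^sup>2 * D"
  shows "annulus r c D \<inter> annulus r c D' = {}"
proof -
  have False if "r * D < dist x c" "r * dist x c < D'" for x
  proof -
    have "r\<^sup>2 * D < r * dist x c"
      using mult_strict_left_mono[OF that(1) \<open>0 < r\<close>] by (simp add: power2_eq_square)
    then show False using that(2) assms(2) by linarith
  qed
  then show ?thesis by (auto simp: annulus_def)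
qed

text \<open>Stated for an arbitrary function \<open>d\<close>, to be used with a reciprocal distance
  for growing radii and with a limit of distances for shrinking ones. Monotonicity extends the
  estimate from consecutive indices to all \<open>j < k\<close>.\<close>

lemma lacunary_sequence:
  fixes d :: "'b \<Rightarrow> real"
  assumes small: "\<And>\<eta>. 0 < \<eta> \<Longrightarrow> \<exists>x. 0 < d x \<and> d x < \<eta>" and r: "0 < r" "r \<le> 1"
  obtains q :: "nat \<Rightarrow> 'b" where "\<And>n. 0 < d (q n)" "\<And>j k. j < k \<Longrightarrow> d (q k) \<le> r * d (q j)"
proof -
  have "\<exists>q. \<forall>n::nat. 0 < d (q n) \<and> d (q (Suc n)) \<le> r * d (q n)"
  proof (rule dependent_nat_choice)
    show "\<exists>x. 0 < d x" using small[of 1] by auto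
    show "\<exists>y. 0 < d y \<and> d y \<le> r * d x" if "0 < d x" for x
      using small[of "r * d x"] r that by (auto intro: less_imp_le)
  qed
  then obtain q where q: "\<And>n::nat. 0 < d (q n)" "\<And>n. d (q (Suc n)) \<le> r * d (q n)" by blast
  have "r * d (q n) \<le> 1 * d (q n)" for n
    using r q(1)[of n] by (intro mult_right_mono) auto
  then have "d (q (Suc n)) \<le> d (q n)" for n using q(2)[of n] by (simp add: order_trans)
  then have "decseq (\<lambda>n. d (q n))" by (rule decseq_SucI)
  then have "d (q k) \<le> r * d (q j)" if "j < k" for j k
    using q(2)[of j] decseqD[of "\<lambda>n. d (q n)" "Suc j" k] that by auto
  with q(1) show thesis by (rule that)
qed

lemma scattered_pairs_concentric:
  fixes t :: "nat \<Rightarrow> 'a::metric_space"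
  assumes "0 < r" "\<And>k. k < K \<Longrightarrow> t k \<noteq> c"
    and "\<And>j k. \<lbrakk>j < k; k < K\<rbrakk> \<Longrightarrow> dist (t k) c \<le> r\<^sup>2 * dist (t j) c \<or> dist (t j) c \<le> r\<^sup>2 * dist (t k) c"
  shows "scattered_pairs r K t (\<lambda>_. c)"
proof -
  have "annulus r c (dist (t j) c) \<inter> annulus r c (dist (t k) c) = {}" if "j < K" "k < K" "j \<noteq> k" for j k
    using assms(3)[of j k] assms(3)[of k j] that annulus_disjoint_concentric[OF \<open>0 < r\<close>]
    by (metis Int_commute nat_neq_iff)
  then show ?thesis using assms(2) by (auto simp: scattered_pairs_def)
qed

text \<open>Lacunary reciprocals of the distances to a fixed point mean that these distances grow at
  least by the factor \<open>1 / r\<^sup>2\<close>.\<close>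

lemma scattered_pairs_unbounded:
  assumes "\<not> bounded (UNIV :: 'a::metric_space set)" and r: "0 < r" "r < 1"
  shows "\<exists>t s :: nat \<Rightarrow> 'a. scattered_pairs r K t s"
proof -
  fix p :: 'a
  have "\<exists>x. 0 < 1 / dist x p \<and> 1 / dist x p < \<eta>" if "0 < \<eta>" for \<eta>
  proof -
    obtain x where "1 / \<eta> < dist p x"
      using assms(1) bounded_any_center[of UNIV p] by (meson UNIV_I not_less)
    moreover from this have D: "0 < dist x p"
      using that by (metis dist_commute less_trans zero_less_divide_1_iff)
    ultimately have "0 < dist x p" "1 / dist x p < \<eta>"
      using that by (simp_all add: dist_commute divide_less_eq mult.commute)
    then show ?thesis by (intro exI[of _ x]) simp
  qed
  then obtain q :: "nat \<Rightarrow> 'a" where q: "\<And>n. 0 < 1 / dist (q n) p"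
    "\<And>j k. j < k \<Longrightarrow> 1 / dist (q k) p \<le> r\<^sup>2 * (1 / dist (q j) p)"
    using r lacunary_sequence[of "\<lambda>x. 1 / dist x p" "r\<^sup>2"] by (auto simp: power_le_one)
  have "q k \<noteq> p" for k using q(1)[of k] by auto
  moreover have "dist (q j) p \<le> r\<^sup>2 * dist (q k) p" if "j < k" for j k
    using q(1)[of j] q(1)[of k] q(2)[OF that] by (simp add: field_simps)
  ultimately have "scattered_pairs r K q (\<lambda>_. p)"
    using r by (intro scattered_pairs_concentric) auto
  then show ?thesis by blast
qed

text \<open>The natural centre is the limit of \<open>s\<close>, which may be missing from the
  space. Its distance function \<open>\<tau>\<close> still exists as a pointwise limit. Once
  \<open>K\<close> points with lacunary values of \<open>\<tau>\<close> are chosen, a late term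
  \<open>s m\<close> serves as the centre.\<close>

lemma scattered_pairs_Cauchy:
  fixes t s :: "nat \<Rightarrow> 'a::metric_space"
  assumes "Cauchy s" and ne: "\<And>n. t n \<noteq> s n" and lim: "(\<lambda>n. dist (t n) (s n)) \<longlonglongrightarrow> 0"
    and r: "0 < r" "r < 1"
  shows "\<exists>t s :: nat \<Rightarrow> 'a. scattered_pairs r K t s"
proof -
  have "convergent (\<lambda>n. dist x (s n))" for x
  proof (rule Cauchy_convergent, rule metric_CauchyI)
    fix e :: real assume "0 < e"
    then obtain M where M: "\<And>m n. \<lbrakk>M \<le> m; M \<le> n\<rbrakk> \<Longrightarrow> dist (s m) (s n) < e"
      using metric_CauchyD[OF \<open>Cauchy s\<close>, of e] by blast
    have "dist (dist x (s m)) (dist x (s n)) \<le> dist (s m) (s n)" for m n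
      using dist_triangle[of x "s m" "s n"] dist_triangle[of x "s n" "s m"]
      by (simp add: dist_real_def dist_commute abs_le_iff)
    then show "\<exists>M. \<forall>m\<ge>M. \<forall>n\<ge>M. dist (dist x (s m)) (dist x (s n)) < e"
      using M by (meson order_le_less_trans)
  qed
  then obtain \<tau> where \<tau>: "\<And>x. (\<lambda>n. dist x (s n)) \<longlonglongrightarrow> \<tau> x"
    unfolding convergent_def by metis
  \<comment> \<open>For late \<open>N\<close> both \<open>\<tau> (t N)\<close> and
    \<open>\<tau> (s N)\<close> are small, and they cannot both vanish because \<open>t N\<close>
    and \<open>s N\<close> are distinct.\<close>
  have "\<exists>x. 0 < \<tau> x \<and> \<tau> x < \<eta>" if "0 < \<eta>" for \<eta>
  proof -
    obtain M where M: "\<And>m n. \<lbrakk>M \<le> m; M \<le> n\<rbrakk> \<Longrightarrow> dist (s m) (s n) < \<eta> / 4"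
      using metric_CauchyD[OF \<open>Cauchy s\<close>, of "\<eta> / 4"] \<open>0 < \<eta>\<close> by auto
    have "\<forall>\<^sub>F n in sequentially. dist (t n) (s n) < \<eta> / 4 \<and> M \<le> n"
      using order_tendstoD(2)[OF lim, of "\<eta> / 4"] \<open>0 < \<eta>\<close>
      by (intro eventually_conj eventually_ge_at_top) auto
    then obtain N where N: "dist (t N) (s N) < \<eta> / 4" "M \<le> N"
      using eventually_happens'[OF sequentially_bot] by blast
    have bounds: "\<tau> (s N) \<le> \<eta> / 4" "\<tau> (t N) \<le> dist (t N) (s N) + \<tau> (s N)"
    proof -
      show "\<tau> (s N) \<le> \<eta> / 4"
        using M[OF N(2)]
        by (intro tendsto_upperbound[OF \<tau>] eventually_sequentiallyI[of M]) (auto intro: less_imp_le)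
      show "\<tau> (t N) \<le> dist (t N) (s N) + \<tau> (s N)"
        by (rule tendsto_le[OF sequentially_bot tendsto_add[OF tendsto_const \<tau>] \<tau>])
          (auto intro!: always_eventually dist_triangle)
    qed
    have "dist (t N) (s N) \<le> \<tau> (t N) + \<tau> (s N)"
      by (rule tendsto_le[OF sequentially_bot tendsto_add[OF \<tau> \<tau>] tendsto_const])
        (auto intro!: always_eventually dist_triangle2)
    moreover have "0 < dist (t N) (s N)" using ne by simp
    ultimately have "0 < \<tau> (t N) \<or> 0 < \<tau> (s N)" by linarith
    then show ?thesis
    proof
      assume "0 < \<tau> (t N)"
      then show ?thesis using bounds N(1) \<open>0 < \<eta>\<close> by (intro exI[of _ "t N"]) linarith
    next
      assume "0 < \<tau> (s N)"
      then show ?thesis using bounds N(1) \<open>0 < \<eta>\<close> by (intro exI[of _ "s N"]) linarith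
    qed
  qed
  \<comment> \<open>The ratio \<open>r\<^sup>2 / 4\<close> absorbs the factor 2 lost above and below
    when \<open>\<tau>\<close> is replaced by the distance to \<open>s m\<close>.\<close>
  then obtain q :: "nat \<Rightarrow> 'a" where q: "\<And>n. 0 < \<tau> (q n)"
    "\<And>j k. j < k \<Longrightarrow> \<tau> (q k) \<le> r\<^sup>2 / 4 * \<tau> (q j)"
    using r power_le_one[of r 2] lacunary_sequence[of \<tau> "r\<^sup>2 / 4"] by auto
  have "\<forall>\<^sub>F n in sequentially. \<tau> (q k) / 2 < dist (q k) (s n) \<and> dist (q k) (s n) < 2 * \<tau> (q k)" for k
    using q(1)[of k] by (intro eventually_conj order_tendstoD[OF \<tau>]) auto
  then have "\<forall>\<^sub>F n in sequentially. \<forall>k\<in>{..<K}.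
      \<tau> (q k) / 2 < dist (q k) (s n) \<and> dist (q k) (s n) < 2 * \<tau> (q k)"
    by (intro eventually_ball_finite) auto
  then have "\<exists>n. \<forall>k\<in>{..<K}. \<tau> (q k) / 2 < dist (q k) (s n) \<and> dist (q k) (s n) < 2 * \<tau> (q k)"
    by (rule eventually_happens'[OF sequentially_bot])
  then obtain m where m: "\<And>k. k < K \<Longrightarrow> \<tau> (q k) / 2 < dist (q k) (s m)"
    "\<And>k. k < K \<Longrightarrow> dist (q k) (s m) < 2 * \<tau> (q k)"
    by auto
  have "scattered_pairs r K q (\<lambda>_. s m)"
  proof (rule scattered_pairs_concentric[OF \<open>0 < r\<close>])
    show "q k \<noteq> s m" if "k < K" for k
      using m(1)[OF that] q(1)[of k] by auto
    show "dist (q k) (s m) \<le> r\<^sup>2 * dist (q j) (s m) \<or> dist (q j) (s m) \<le> r\<^sup>2 * dist (q k) (s m)"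
      if "j < k" "k < K" for j k
    proof -
      have "dist (q k) (s m) \<le> 2 * (r\<^sup>2 / 4 * \<tau> (q j))"
        using m(2)[OF that(2)] q(2)[OF that(1)] by linarith
      also have "\<dots> = r\<^sup>2 * (\<tau> (q j) / 2)" by simp
      also have "\<dots> \<le> r\<^sup>2 * dist (q j) (s m)"
        using m(1)[of j] that by (intro mult_left_mono) auto
      finally show ?thesis ..
    qed
  qed
  then show ?thesis by blast
qed

text \<open>Failure of total boundedness gives a \<open>\<delta>\<close> and arbitrarily many terms
  of \<open>s\<close> at mutual distances at least \<open>\<delta>\<close>. For late terms the outer
  radii are below \<open>\<delta> / 2\<close>, so the annuli lie in disjoint balls.\<close>

lemma scattered_pairs_separated:
  fixes t s :: "nat \<Rightarrow> 'a::metric_space"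
  assumes "\<not> Met_TC.mtotally_bounded (range s)"
    and ne: "\<And>n. t n \<noteq> s n" and lim: "(\<lambda>n. dist (t n) (s n)) \<longlonglongrightarrow> 0"
    and r: "0 < r" "r < 1"
  shows "\<exists>t s :: nat \<Rightarrow> 'a. scattered_pairs r K t s"
proof -
  obtain \<delta> where \<delta>: "0 < \<delta>" and sep: "\<And>F. \<lbrakk>finite F; F \<subseteq> range s\<rbrakk> \<Longrightarrow> \<exists>k. \<forall>c\<in>F. \<delta> \<le> dist (s k) c"
  proof -
    obtain \<delta> where "0 < \<delta>"
      and \<delta>: "\<not> (\<exists>F. finite F \<and> F \<subseteq> range s \<and> range s \<subseteq> (\<Union>x\<in>F. ball x \<delta>))"
      using assms(1) unfolding Met_TC.mtotally_bounded_def mball_eq_ball by meson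
    have "\<exists>k. \<forall>c\<in>F. \<delta> \<le> dist (s k) c" if "finite F" "F \<subseteq> range s" for F
    proof -
      have "\<not> range s \<subseteq> (\<Union>x\<in>F. ball x \<delta>)" using \<delta> that by blast
      then obtain k where "s k \<notin> (\<Union>x\<in>F. ball x \<delta>)" by blast
      then have "\<forall>c\<in>F. \<delta> \<le> dist (s k) c" by (auto simp: not_less dist_commute)
      then show ?thesis ..
    qed
    with \<open>0 < \<delta>\<close> show thesis by (rule that)
  qed
  have "\<forall>\<^sub>F n in sequentially. dist (t n) (s n) < r * (\<delta> / 2)"
    using r \<delta> by (intro order_tendstoD(2)[OF lim]) auto
  then obtain N where N: "\<And>n. N \<le> n \<Longrightarrow> dist (t n) (s n) < r * (\<delta> / 2)"
    unfolding eventually_sequentially by blast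
  have "\<exists>\<iota>. \<forall>k<K. N \<le> \<iota> k \<and> (\<forall>j<k. \<delta> \<le> dist (s (\<iota> k)) (s (\<iota> j)))"
  proof (induction K)
    case (Suc K)
    then obtain \<iota> where \<iota>: "\<And>k. k < K \<Longrightarrow> N \<le> \<iota> k \<and> (\<forall>j<k. \<delta> \<le> dist (s (\<iota> k)) (s (\<iota> j)))" by blast
    \<comment> \<open>With the first \<open>N\<close> terms of \<open>s\<close> in the finite set,
      the new index is forced to be at least \<open>N\<close>.\<close>
    have "finite (s ` {..<N} \<union> s ` \<iota> ` {..<K})" "s ` {..<N} \<union> s ` \<iota> ` {..<K} \<subseteq> range s" by auto
    from sep[OF this] obtain m
      where m: "\<And>c. c \<in> s ` {..<N} \<union> s ` \<iota> ` {..<K} \<Longrightarrow> \<delta> \<le> dist (s m) c"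
      by blast
    have "N \<le> m"
    proof (rule ccontr)
      assume "\<not> N \<le> m"
      then have "\<delta> \<le> dist (s m) (s m)" by (intro m) auto
      then show False using \<delta> by simp
    qed
    then show ?case
      using \<iota> m by (intro exI[of _ "\<iota>(K := m)"]) (auto simp: less_Suc_eq)
  qed simp
  then obtain \<iota> where \<iota>: "\<And>k. k < K \<Longrightarrow> N \<le> \<iota> k"
    "\<And>j k. \<lbrakk>j < k; k < K\<rbrakk> \<Longrightarrow> \<delta> \<le> dist (s (\<iota> k)) (s (\<iota> j))" by blast
  have far: "\<delta> \<le> dist (s (\<iota> k)) (s (\<iota> j))" if "j < K" "k < K" "j \<noteq> k" for j k
    using \<iota>(2)[of j k] \<iota>(2)[of k j] that by (metis dist_commute nat_neq_iff)
  have sub: "annulus r (s (\<iota> k)) (dist (t (\<iota> k)) (s (\<iota> k))) \<subseteq> ball (s (\<iota> k)) (\<delta> / 2)" if "k < K" for k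
  proof
    fix x assume "x \<in> annulus r (s (\<iota> k)) (dist (t (\<iota> k)) (s (\<iota> k)))"
    then have "r * dist x (s (\<iota> k)) < r * (\<delta> / 2)"
      using N[OF \<iota>(1)[OF that]] by (simp add: annulus_def)
    then show "x \<in> ball (s (\<iota> k)) (\<delta> / 2)" using r by (simp add: dist_commute)
  qed
  have "scattered_pairs r K (t \<circ> \<iota>) (s \<circ> \<iota>)"
    unfolding scattered_pairs_def
  proof (intro conjI allI impI)
    fix j k assume jk: "j < K" "k < K" "j \<noteq> k"
    have "ball (s (\<iota> j)) (\<delta> / 2) \<inter> ball (s (\<iota> k)) (\<delta> / 2) = {}"
      using far[OF jk] by (intro disjoint_ballI) (simp add: dist_commute)
    then show "annulus r ((s \<circ> \<iota>) j) (dist ((t \<circ> \<iota>) j) ((s \<circ> \<iota>) j)) \<inter>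
        annulus r ((s \<circ> \<iota>) k) (dist ((t \<circ> \<iota>) k) ((s \<circ> \<iota>) k)) = {}"
      using sub[OF jk(1)] sub[OF jk(2)] by auto
  qed (use ne in simp)
  then show ?thesis by blast
qed

lemma scattered_pairs_not_uniform_discrete:
  assumes "\<not> uniform_discrete (UNIV :: 'a::metric_space set)" and r: "0 < r" "r < 1"
  shows "\<exists>t s :: nat \<Rightarrow> 'a. scattered_pairs r K t s"
proof -
  have "\<exists>x y :: 'a. x \<noteq> y \<and> dist x y < inverse (real (Suc n))" for n
    using assms(1) unfolding uniform_discrete_def
    by (metis inverse_positive_iff_positive of_nat_0_less_iff zero_less_Suc)
  then obtain t s :: "nat \<Rightarrow> 'a" where ne: "\<And>n. t n \<noteq> s n"
    and ts: "\<And>n. dist (t n) (s n) < inverse (real (Suc n))"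
    by metis
  have lim: "(\<lambda>n. dist (t n) (s n)) \<longlonglongrightarrow> 0"
  proof (rule Lim_null_comparison[OF always_eventually LIMSEQ_inverse_real_of_nat])
    show "\<forall>n. norm (dist (t n) (s n)) \<le> inverse (real (Suc n))"
      using ts by (metis less_imp_le real_norm_def abs_of_nonneg zero_le_dist)
  qed
  show ?thesis
  proof (cases "Met_TC.mtotally_bounded (range s)")
    case True
    then obtain h :: "nat \<Rightarrow> nat" where h: "strict_mono h" "Cauchy (s \<circ> h)"
      unfolding Met_TC.mtotally_bounded_sequentially by auto
    show ?thesis
      using h(2) _ _ r
    proof (rule scattered_pairs_Cauchy)
      show "(t \<circ> h) n \<noteq> (s \<circ> h) n" for n using ne by simp
      show "(\<lambda>n. dist ((t \<circ> h) n) ((s \<circ> h) n)) \<longlonglongrightarrow> 0"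
        using LIMSEQ_subseq_LIMSEQ[OF lim h(1)] by (simp add: comp_def)
    qed
  next
    case False
    then show ?thesis using ne lim r by (rule scattered_pairs_separated)
  qed
qed

section \<open>Free ultrafilters\<close>

text \<open>Without a free ultrafilter \<open>USD2P\<close> would hold vacuously, so one is needed
  to refute it. Zorn's lemma gives a maximal family of sets with infinite finite intersections:
  maximality decides every set, and infinite intersections exclude single points.\<close>

lemma free_ultrafilter_exists:
  assumes "infinite (UNIV :: 'i set)"
  shows "\<exists>U :: 'i filter. free_ultrafilter U"
proof -
  define \<A> :: "'i set set set" where "\<A> = {\<F>. \<forall>T. finite T \<and> T \<subseteq> \<F> \<longrightarrow> infinite (\<Inter>T)}"
  have "\<exists>M\<in>\<A>. \<forall>X\<in>\<A>. M \<subseteq> X \<longrightarrow> X = M"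
  proof (rule subset_Zorn')
    fix \<C> assume chain: "subset.chain \<A> \<C>"
    have "infinite (\<Inter>T)" if T: "finite T" "T \<subseteq> \<Union>\<C>" for T
    proof (cases "\<C> = {}")
      \<comment> \<open>The union of the empty chain is empty, so \<open>T\<close> is empty and
        \<open>\<Inter>T\<close> is the whole infinite type.\<close>
      case True
      then show ?thesis using T assms by auto
    next
      case False
      obtain \<F> where "\<F> \<in> \<C>" "T \<subseteq> \<F>"
        by (rule finite_subset_Union_chain[OF T False chain])
      moreover have "\<F> \<in> \<A>" using chain \<open>\<F> \<in> \<C>\<close> by (auto simp: subset.chain_def)
      ultimately show ?thesis using T(1) by (auto simp: \<A>_def)
    qed
    then show "\<Union>\<C> \<in> \<A>" by (simp add: \<A>_def)
  qed
  then obtain M where "M \<in> \<A>" and max: "\<And>X. \<lbrakk>X \<in> \<A>; M \<subseteq> X\<rbrakk> \<Longrightarrow> X = M"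
    by blast
  then have M: "\<And>T. \<lbrakk>finite T; T \<subseteq> M\<rbrakk> \<Longrightarrow> infinite (\<Inter>T)"
    by (simp add: \<A>_def)
  define U where "U = (INF S\<in>M. principal S)"
  have fin: "eventually P (INF S\<in>T. principal S) \<longleftrightarrow> (\<forall>x\<in>\<Inter>T. P x)" if "finite T" for P and T :: "'i set set"
    using INF_principal_finite[OF that, of "\<lambda>S. S"] by (simp add: eventually_principal)
  have ev: "eventually P U \<longleftrightarrow> (\<exists>T\<subseteq>M. finite T \<and> (\<forall>x\<in>\<Inter>T. P x))" for P
    unfolding U_def using eventually_INF[of P principal M] fin[of _ P] by auto
  have dichotomy: "S \<in> M \<or> - S \<in> M" for S
  proof (rule ccontr)
    assume "\<not> ?thesis"
    then have "insert S M \<notin> \<A>" "insert (- S) M \<notin> \<A>" using max by blast+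
    then have "\<exists>T. finite T \<and> T \<subseteq> insert S M \<and> finite (\<Inter>T)"
      "\<exists>T. finite T \<and> T \<subseteq> insert (- S) M \<and> finite (\<Inter>T)"
      by (simp_all add: \<A>_def)
    then obtain T1 T2 where T: "finite T1" "T1 \<subseteq> insert S M" "finite (\<Inter>T1)"
      "finite T2" "T2 \<subseteq> insert (- S) M" "finite (\<Inter>T2)"
      by metis
    \<comment> \<open>A point of the left side lies in \<open>S\<close>, and then in every member of
      \<open>T1\<close>, or in \<open>- S\<close>, and then in every member of
      \<open>T2\<close>.\<close>
    have "\<Inter>(T1 - {S} \<union> (T2 - {- S})) \<subseteq> \<Inter>T1 \<union> \<Inter>T2" by blast
    then have "finite (\<Inter>(T1 - {S} \<union> (T2 - {- S})))"
      using T(3,6) by (meson finite_UnI finite_subset)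
    then show False using M[of "T1 - {S} \<union> (T2 - {- S})"] T by auto
  qed
  have "eventually P U \<or> eventually (\<lambda>i. \<not> P i) U" for P
  proof -
    have "eventually Q U" if "{x. Q x} \<in> M" for Q
      unfolding ev using that by (intro exI[of _ "{{x. Q x}}"]) auto
    then show ?thesis using dichotomy[of "{x. P x}"] by (auto simp: Collect_neg_eq)
  qed
  moreover have "\<not> eventually (\<lambda>i. i = j) U" for j
  proof
    assume "eventually (\<lambda>i. i = j) U"
    then obtain T where T: "T \<subseteq> M" "finite T" "\<Inter>T \<subseteq> {j}" unfolding ev by blast
    then show False using M[OF T(2,1)] by (meson finite.emptyI finite.insertI finite_subset)
  qed
  moreover have "U \<noteq> bot"
    using \<open>\<not> eventually (\<lambda>i. i = undefined) U\<close> by auto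
  ultimately show ?thesis unfolding free_ultrafilter_def by blast
qed

text \<open>The image filter contains a compact interval, so it has a cluster point. An ultrafilter
  decides every neighbourhood, hence the cluster point is a limit.\<close>

lemma free_ultrafilter_convergent:
  fixes a :: "'i \<Rightarrow> real"
  assumes U: "free_ultrafilter U" and a: "\<And>i. \<bar>a i\<bar> \<le> b"
  shows "\<exists>l. (a \<longlongrightarrow> l) U"
proof -
  have "filtermap a U \<noteq> bot" using U by (simp add: free_ultrafilter_def filtermap_bot_iff)
  moreover have "eventually (\<lambda>x. x \<in> {- b..b}) (filtermap a U)"
    using a by (auto simp: eventually_filtermap abs_le_iff intro!: always_eventually) (metis minus_le_iff)
  ultimately obtain l where l: "inf (nhds l) (filtermap a U) \<noteq> bot"
    using compact_Icc[of "- b" b] unfolding compact_filter by blast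
  have "(a \<longlongrightarrow> l) U"
  proof (rule topological_tendstoI)
    fix S assume S: "open S" "l \<in> S"
    show "eventually (\<lambda>i. a i \<in> S) U"
    proof (rule ccontr)
      assume "\<not> eventually (\<lambda>i. a i \<in> S) U"
      then have "eventually (\<lambda>x. x \<notin> S) (filtermap a U)"
        using U unfolding free_ultrafilter_def eventually_filtermap by blast
      moreover have "eventually (\<lambda>x. x \<in> S) (nhds l)" using S by (auto simp: eventually_nhds)
      ultimately have "eventually (\<lambda>x. False) (inf (nhds l) (filtermap a U))"
        unfolding eventually_inf by blast
      then show False using l by (simp add: trivial_limit_def)
    qed
  qed
  then show ?thesis ..
qed

section \<open>Finite spaces\<close>

lemma vdiameter_le:
  assumes "0 \<le> b" "\<And>x y. \<lbrakk>x \<in> S; y \<in> S\<rbrakk> \<Longrightarrow> vnorm X (vdiff X x y) \<le> b"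
  shows "vdiameter X S \<le> b"
  using assms by (auto simp: vdiameter_def intro!: cSUP_least)

section \<open>Slices, norms and functionals in ultrapowers\<close>

context seminormed
begin

text \<open>A slice is a convex combination of slices with a single term of weight 1.\<close>

lemma SD2P_vdiameter_slice:
  assumes "SD2P X" "is_slice X S"
  shows "vdiameter X S = 2"
proof -
  let ?C = "{lincomb X (\<lambda>_. 1) x 1 |x. \<forall>i<1. x i \<in> S}"
  have "S \<subseteq> vcarrier X" using assms(2) by (auto simp: is_slice_def slice_def unit_ball_def)
  then have lin: "lincomb X (\<lambda>_. 1) x 1 = x 0" if "x 0 \<in> S" for x
    using that by auto
  have "S = ?C"
  proof
    show "S \<subseteq> ?C"
    proof
      fix a assume "a \<in> S"
      then show "a \<in> ?C" using lin[of "\<lambda>_. a"] by (intro CollectI exI[of _ "\<lambda>_. a"]) auto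
    qed
    show "?C \<subseteq> S" using lin by auto
  qed
  moreover have "is_convex_comb_slices X ?C"
    unfolding is_convex_comb_slices_def using assms(2)
    by (intro exI[of _ 1] exI[of _ "\<lambda>_. 1"] exI[of _ "\<lambda>_. S"]) auto
  ultimately show ?thesis using assms(1) unfolding SD2P_def by metis
qed

text \<open>The sequence \<open>z\<close> cancels \<open>c\<close> in the coordinates where the
  bound fails. It vanishes along \<open>U\<close>, so adding it does not leave the class of
  \<open>c\<close>.\<close>

lemma norm_ultrapower_le:
  assumes c: "c \<in> vcarrier (linf_space X)" and "0 \<le> b"
    and ev: "\<forall>\<^sub>F n in U. vnorm X (c n) \<le> b"
  shows "vnorm (ultrapower X U) (vcoset (linf_space X) (null_seqs X U) c) \<le> b"
proof -
  interpret L: seminormed_quotient "linf_space X" "null_seqs X U"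
    by (rule seminormed_quotient_null_seqs)
  define z where "z n = (if vnorm X (c n) \<le> b then vzero X else vscale X (-1) (c n))" for n
  have cX: "c n \<in> vcarrier X" for n using c by simp
  have z: "z \<in> vcarrier (linf_space X)"
  proof (rule linf_space_memI)
    show "z n \<in> vcarrier X" for n using cX by (simp add: z_def)
    show "vnorm X (z n) \<le> vnorm (linf_space X) c" for n
      using norm_le_linf_space[OF c, of n] norm_scale_le[OF cX, of "-1" n] norm_nonneg[OF cX, of n]
      by (auto simp: z_def norm_zero simp del: linf_space_sel)
  qed
  have "\<forall>\<^sub>F n in U. vnorm X (z n) = 0"
    using ev by eventually_elim (simp add: z_def norm_zero)
  then have "((\<lambda>n. vnorm X (z n)) \<longlongrightarrow> 0) U" by (rule tendsto_eventually)
  with z have "z \<in> null_seqs X U" by simp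
  then have "vadd (linf_space X) c z \<in> L.cls c" unfolding vcoset_def by blast
  then have "vnorm L.Q (L.cls c) \<le> vnorm (linf_space X) (vadd (linf_space X) c z)"
    by (rule L.quotient_norm_le[OF c])
  also have "\<dots> \<le> b"
  proof (rule norm_linf_space_le)
    show "vnorm X (vadd (linf_space X) c z n) \<le> b" for n
      using cX diff_self[OF cX] \<open>0 \<le> b\<close> by (simp add: z_def norm_zero vdiff_def)
  qed
  finally show ?thesis by (simp add: ultrapower_def)
qed

text \<open>The functional is the limit of \<open>\<psi> (g n)\<close> along \<open>U\<close>, which
  exists by boundedness and is 0 on null sequences.\<close>

lemma dual_ultrapower_exists:
  assumes U: "free_ultrafilter U" and \<psi>: "\<psi> \<in> dual_space X"
  shows "\<exists>\<phi>\<in>dual_space (ultrapower X U). \<forall>g\<in>vcarrier (linf_space X).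
    ((\<lambda>n. \<psi> (g n)) \<longlongrightarrow> \<phi> (vcoset (linf_space X) (null_seqs X U) g)) U"
proof -
  interpret L: seminormed_quotient "linf_space X" "null_seqs X U"
    by (rule seminormed_quotient_null_seqs)
  have nb: "U \<noteq> bot" using U by (simp add: free_ultrafilter_def)
  obtain K' where "\<And>x. x \<in> vcarrier X \<Longrightarrow> \<bar>\<psi> x\<bar> \<le> K' * vnorm X x"
    using \<psi> unfolding dual_space_def by blast
  \<comment> \<open>Adding 1 makes the constant positive, so one can divide by it when the bound is
    carried over to the infimum.\<close>
  then have K: "\<bar>\<psi> x\<bar> \<le> (\<bar>K'\<bar> + 1) * vnorm X x" if "x \<in> vcarrier X" for x
    using that norm_nonneg[OF that] mult_right_mono[of K' "\<bar>K'\<bar> + 1" "vnorm X x"]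
    by (force intro: order_trans)
  define K where "K = \<bar>K'\<bar> + 1"
  have "0 < K" by (simp add: K_def)
  have bound: "\<bar>\<psi> (g n)\<bar> \<le> K * vnorm (linf_space X) g" if "g \<in> vcarrier (linf_space X)" for g n
  proof -
    have "\<bar>\<psi> (g n)\<bar> \<le> K * vnorm X (g n)" using K that by (simp add: K_def)
    also have "\<dots> \<le> K * vnorm (linf_space X) g"
      using \<open>0 < K\<close> norm_le_linf_space[OF that] by (intro mult_left_mono) auto
    finally show ?thesis .
  qed
  define \<Lambda> where "\<Lambda> g = Lim U (\<lambda>n. \<psi> (g n))" for g
  have \<Lambda>: "((\<lambda>n. \<psi> (g n)) \<longlongrightarrow> \<Lambda> g) U" if g: "g \<in> vcarrier (linf_space X)" for g
  proof -
    obtain l where "((\<lambda>n. \<psi> (g n)) \<longlongrightarrow> l) U"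
      using free_ultrafilter_convergent[OF U, of "\<lambda>n. \<psi> (g n)"] bound[OF g] by blast
    then show ?thesis unfolding \<Lambda>_def using tendsto_Lim[OF nb] by metis
  qed
  have \<Lambda>_eqI: "\<Lambda> g = l" if "((\<lambda>n. \<psi> (g n)) \<longlongrightarrow> l) U" for g l
    unfolding \<Lambda>_def using nb that by (rule tendsto_Lim)
  have \<Lambda>_le: "\<bar>\<Lambda> g\<bar> \<le> K * vnorm (linf_space X) g" if g: "g \<in> vcarrier (linf_space X)" for g
    using tendsto_upperbound[OF tendsto_rabs[OF \<Lambda>[OF g]] always_eventually nb] bound[OF g] by blast
  have \<Lambda>_cls: "\<Lambda> a = \<Lambda> g" if g: "g \<in> vcarrier (linf_space X)" and "a \<in> L.cls g" for g a
  proof (rule \<Lambda>_eqI)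
    obtain z where z: "z \<in> null_seqs X U" "a = vadd (linf_space X) g z"
      using \<open>a \<in> L.cls g\<close> unfolding vcoset_def by blast
    have "((\<lambda>n. K * vnorm X (z n)) \<longlongrightarrow> K * 0) U" using z by (intro tendsto_mult_left) simp
    moreover have "norm (\<psi> (z n)) \<le> K * vnorm X (z n)" for n using z K by (simp add: K_def)
    ultimately have "((\<lambda>n. \<psi> (z n)) \<longlongrightarrow> 0) U"
      using Lim_null_comparison[OF always_eventually] by fastforce
    then have "((\<lambda>n. \<psi> (g n) + \<psi> (z n)) \<longlongrightarrow> \<Lambda> g + 0) U"
      using \<Lambda>[OF g] by (intro tendsto_add)
    moreover have "\<psi> (a n) = \<psi> (g n) + \<psi> (z n)" for n
      using \<psi> g z by (simp add: dual_space_def)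
    ultimately show "((\<lambda>n. \<psi> (a n)) \<longlongrightarrow> \<Lambda> g) U" by simp
  qed
  \<comment> \<open>The choice of representative is harmless because \<open>\<Lambda>\<close> is
    constant on classes.\<close>
  define \<phi> where "\<phi> A = \<Lambda> (SOME a. a \<in> A)" for A
  have \<phi>: "\<phi> (L.cls g) = \<Lambda> g" if g: "g \<in> vcarrier (linf_space X)" for g
    unfolding \<phi>_def using someI[of "\<lambda>a. a \<in> L.cls g", OF L.cls_self[OF g]] by (rule \<Lambda>_cls[OF g])
  have "\<phi> \<in> dual_space L.Q"
    unfolding dual_space_def
  proof (intro CollectI conjI ballI allI)
    fix A B assume "A \<in> vcarrier L.Q" "B \<in> vcarrier L.Q"
    obtain a where a: "a \<in> vcarrier (linf_space X)" "A = L.cls a"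
      using \<open>A \<in> vcarrier L.Q\<close> by (rule L.quotient_carrierE)
    obtain b where b: "b \<in> vcarrier (linf_space X)" "B = L.cls b"
      using \<open>B \<in> vcarrier L.Q\<close> by (rule L.quotient_carrierE)
    have "\<Lambda> (vadd (linf_space X) a b) = \<Lambda> a + \<Lambda> b"
      using tendsto_add[OF \<Lambda>[OF a(1)] \<Lambda>[OF b(1)]] a(1) b(1) \<psi>
      by (intro \<Lambda>_eqI) (simp add: dual_space_def)
    then show "\<phi> (vadd L.Q A B) = \<phi> A + \<phi> B"
      unfolding a(2) b(2) L.quotient_add[OF a(1) b(1)] \<phi>[OF a(1)] \<phi>[OF b(1)]
        \<phi>[OF L.add_closed[OF a(1) b(1)]] .
  next
    fix c A assume "A \<in> vcarrier L.Q"
    then obtain a where a: "a \<in> vcarrier (linf_space X)" "A = L.cls a"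
      by (rule L.quotient_carrierE)
    have "\<Lambda> (vscale (linf_space X) c a) = c * \<Lambda> a"
      using tendsto_mult_left[OF \<Lambda>[OF a(1)], of c] a(1) \<psi>
      by (intro \<Lambda>_eqI) (simp add: dual_space_def)
    then show "\<phi> (vscale L.Q c A) = c * \<phi> A"
      unfolding a(2) L.quotient_scale[OF a(1)] \<phi>[OF a(1)] \<phi>[OF L.scale_closed[OF a(1)]] .
  next
    show "\<exists>K. \<forall>A\<in>vcarrier L.Q. \<bar>\<phi> A\<bar> \<le> K * vnorm L.Q A"
    proof (intro exI[of _ K] ballI)
      fix A assume "A \<in> vcarrier L.Q"
      then obtain g where g: "g \<in> vcarrier (linf_space X)" "A = L.cls g"
        by (rule L.quotient_carrierE)
      have "\<bar>\<Lambda> g\<bar> / K \<le> vnorm L.Q (L.cls g)"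
      proof (rule L.quotient_norm_ge[OF g(1)])
        show "\<bar>\<Lambda> g\<bar> / K \<le> vnorm (linf_space X) a" if "a \<in> L.cls g" for a
          using \<Lambda>_le[OF L.cls_closed[OF g(1) that]] \<Lambda>_cls[OF g(1) that] \<open>0 < K\<close>
          by (simp add: divide_le_eq mult.commute)
      qed
      then show "\<bar>\<phi> A\<bar> \<le> K * vnorm L.Q A"
        using \<open>0 < K\<close> unfolding g(2) \<phi>[OF g(1)] by (simp add: divide_le_eq mult.commute)
    qed
  qed
  moreover have "\<forall>g\<in>vcarrier (linf_space X). ((\<lambda>n. \<psi> (g n)) \<longlongrightarrow> \<phi> (L.cls g)) U"
    using \<phi> \<Lambda> by auto
  ultimately show ?thesis unfolding ultrapower_def by (intro bexI[of _ \<phi>])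
qed

end

text \<open>Functions in the unit ball lie below the distance to \<open>p\<close>, so one with
  almost maximal sum is close to this distance at every point. Since distinct points are at least
  \<open>m\<close> apart, uniformly close functions are also close in the Lipschitz norm; this gives
  a slice of diameter at most 1.\<close>

lemma not_USD2P_finite:
  fixes p :: "'a::metric_space"
  assumes fin: "finite (UNIV :: 'a set)"
  shows "\<not> USD2P (Lip0 p)"
proof
  assume "USD2P (Lip0 p)"
  obtain U :: "nat filter" where U: "free_ultrafilter U"
    using free_ultrafilter_exists infinite_UNIV_nat by blast
  then have nb: "U \<noteq> bot" by (simp add: free_ultrafilter_def)
  interpret seminormed "Lip0 p" by (rule seminormed_Lip0)
  interpret L: seminormed_quotient "linf_space (Lip0 p)" "null_seqs (Lip0 p) U"
    by (rule seminormed_quotient_null_seqs)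
  have up: "ultrapower (Lip0 p) U = L.Q" by (simp add: ultrapower_def)
  interpret Q: seminormed L.Q by (rule L.seminormed_quotient_nspace)
  obtain m :: real where m: "0 < m" "\<And>x y :: 'a. x \<noteq> y \<Longrightarrow> m \<le> dist x y"
  proof -
    \<comment> \<open>The extra element 1 keeps the set nonempty when the space is a single
      point.\<close>
    define A where "A = insert 1 ((\<lambda>(x :: 'a, y). dist x y) ` {(x, y). x \<noteq> y})"
    have "finite A" unfolding A_def
      by (intro finite.insertI finite_imageI finite_subset[OF subset_UNIV finite_Prod_UNIV] fin)
    moreover have "A \<noteq> {}" "\<forall>a\<in>A. 0 < a" by (auto simp: A_def)
    ultimately have "0 < Min A" "\<And>a. a \<in> A \<Longrightarrow> Min A \<le> a" by auto
    then show thesis by (intro that[of "Min A"]) (auto simp: A_def)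
  qed
  define D where "D = (\<Sum>x\<in>UNIV. dist x p)"
  have D: "dist x p \<le> D" for x
    unfolding D_def using fin by (intro member_le_sum) auto
  have D0: "0 \<le> D" unfolding D_def by (intro sum_nonneg) auto
  define \<psi> where "\<psi> f = (\<Sum>x\<in>UNIV. f x)" for f :: "'a \<Rightarrow> real"
  have point: "\<bar>f x\<bar> \<le> vnorm (Lip0 p) f * dist x p" if "f \<in> vcarrier (Lip0 p)" for f x
    using lipschitz_onD[OF lipschitz_norm_Lip0[OF that], of x p] that by (simp add: dist_real_def)
  have \<psi>: "\<psi> \<in> dual_space (Lip0 p)"
    unfolding dual_space_def
  proof (intro CollectI conjI ballI allI exI[of _ D])
    fix f assume f: "f \<in> vcarrier (Lip0 p)"
    have "\<bar>\<psi> f\<bar> \<le> (\<Sum>x\<in>UNIV. vnorm (Lip0 p) f * dist x p)"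
      unfolding \<psi>_def by (intro order_trans[OF sum_abs sum_mono] point f)
    also have "\<dots> = D * vnorm (Lip0 p) f"
      unfolding D_def sum_distrib_right by (intro sum.cong refl mult.commute)
    finally show "\<bar>\<psi> f\<bar> \<le> D * vnorm (Lip0 p) f" .
  qed (simp_all add: \<psi>_def sum.distrib sum_distrib_left)
  obtain \<phi> where \<phi>: "\<phi> \<in> dual_space L.Q"
    and lims: "\<forall>g\<in>vcarrier (linf_space (Lip0 p)). ((\<lambda>n. \<psi> (g n)) \<longlongrightarrow> \<phi> (L.cls g)) U"
    using dual_ultrapower_exists[OF U \<psi>] unfolding up by (elim bexE)
  have lim: "((\<lambda>n. \<psi> (g n)) \<longlongrightarrow> \<phi> (L.cls g)) U"
    if "g \<in> vcarrier (linf_space (Lip0 p))" for g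
    using bspec[OF lims that] .
  define e where "e = (\<lambda>n::nat. \<lambda>x. dist x p)"
  have e_ball: "e n \<in> vcarrier (Lip0 p) \<and> vnorm (Lip0 p) (e n) \<le> 1" for n
  proof (subst norm_Lip0_le_iff)
    have "dist x p - dist y p \<le> 1 * dist x y" for x y
      using dist_triangle[of x p y] by simp
    then show "1-lipschitz_on UNIV (e n)" unfolding e_def by (rule lipschitz_on_realI) simp
  qed (simp_all add: e_def)
  have e: "e \<in> vcarrier (linf_space (Lip0 p))"
    using e_ball by (intro linf_space_memI) auto
  have \<phi>_e: "\<phi> (L.cls e) = D"
    using tendsto_unique[OF nb lim[OF e], of D] by (simp add: e_def \<psi>_def D_def)
  have "L.cls e \<in> unit_ball L.Q"
    using L.quotient_norm_le[OF e L.cls_self[OF e]] norm_linf_space_le[of "Lip0 p" e 1] e_ball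
      L.cls_quotient_carrier[OF e]
    unfolding unit_ball_def by fastforce
  \<comment> \<open>This lower bound on the supremum is enough: members \<open>A\<close> of the
    slice below satisfy \<open>\<phi> A > D - m / 4\<close>.\<close>
  from cSUP_upper[OF this Q.dual_bdd_above[OF \<phi>]]
  have sup: "D \<le> Sup (\<phi> ` unit_ball L.Q)" by (simp only: \<phi>_e)
  \<comment> \<open>Representatives have norm below \<open>1 + \<eta>\<close>; the excess
    contributes at most \<open>m / 8\<close>, both at a single point and in the sum over all points.
    Using \<open>D + 1\<close> avoids the denominator 0 in the one-point space.\<close>
  define \<eta> where "\<eta> = m / (8 * (D + 1))"
  have \<eta>: "0 < \<eta>" "\<eta> * D \<le> m / 8"
  proof -
    show "0 < \<eta>" using m D0 by (simp add: \<eta>_def)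
    have "\<eta> * D \<le> \<eta> * (D + 1)" using \<open>0 < \<eta>\<close> by simp
    also have "\<eta> * (D + 1) = m / 8" using D0 by (simp add: \<eta>_def field_simps)
    finally show "\<eta> * D \<le> m / 8" .
  qed
  have rep: "\<exists>a. a \<in> vcarrier (linf_space (Lip0 p)) \<and> A = L.cls a \<and>
      (\<forall>\<^sub>F n in U. \<forall>x. dist x p - 3 * m / 8 \<le> a n x \<and> a n x \<le> dist x p + m / 8)"
    if A: "A \<in> slice L.Q \<phi> (m / 4)" for A
  proof -
    have "A \<in> vcarrier L.Q" "vnorm L.Q A < 1 + \<eta>" and \<phi>A: "D - m / 4 < \<phi> A"
      using A sup \<eta>(1) by (auto simp: slice_def unit_ball_def)
    obtain a where a: "a \<in> vcarrier (linf_space (Lip0 p))" "A = L.cls a"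
      "vnorm (linf_space (Lip0 p)) a < 1 + \<eta>"
      using \<open>A \<in> vcarrier L.Q\<close> \<open>vnorm L.Q A < 1 + \<eta>\<close> by (rule L.quotient_representative)
    have upper: "a n x \<le> dist x p + \<eta> * dist x p" for n x
    proof -
      have "a n x \<le> vnorm (Lip0 p) (a n) * dist x p"
        using point[of "a n" x] a(1) by simp
      also have "\<dots> \<le> (1 + \<eta>) * dist x p"
        using norm_le_linf_space[OF a(1), of n] a(3) by (intro mult_right_mono) auto
      finally show ?thesis by (simp add: algebra_simps)
    qed
    have "\<forall>\<^sub>F n in U. D - m / 4 < \<psi> (a n)"
      using order_tendstoD(1)[OF lim[OF a(1)]] \<phi>A a(2) by simp
    then have "\<forall>\<^sub>F n in U. \<forall>x. dist x p - 3 * m / 8 \<le> a n x \<and> a n x \<le> dist x p + m / 8"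
    proof eventually_elim
      case (elim n)
      show ?case
      proof (intro allI conjI)
        fix x
        have "\<eta> * dist x p \<le> m / 8"
          using \<eta> mult_left_mono[OF D, of \<eta> x] by linarith
        then show "a n x \<le> dist x p + m / 8" using upper[of n x] by linarith
        \<comment> \<open>The other values sum to at most \<open>D - dist x p + m / 8\<close>, so a
          total above \<open>D - m / 4\<close> forces \<open>a n x\<close> to be at least
          \<open>dist x p - 3 * m / 8\<close>.\<close>
        have "\<psi> (a n) = a n x + (\<Sum>y\<in>UNIV - {x}. a n y)"
          unfolding \<psi>_def using fin by (rule sum.remove) simp
        also have "(\<Sum>y\<in>UNIV - {x}. a n y) \<le> (\<Sum>y\<in>UNIV - {x}. dist y p + \<eta> * dist y p)"
          by (intro sum_mono upper)
        also have "\<dots> = (1 + \<eta>) * (\<Sum>y\<in>UNIV - {x}. dist y p)"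
          by (simp add: sum.distrib sum_distrib_left algebra_simps)
        also have "(\<Sum>y\<in>UNIV - {x}. dist y p) = D - dist x p"
          unfolding D_def using fin by (simp add: sum_diff1)
        also have "(1 + \<eta>) * (D - dist x p) \<le> D - dist x p + m / 8"
        proof -
          have "\<eta> * (D - dist x p) \<le> \<eta> * D" using \<eta>(1) by (intro mult_left_mono) auto
          then show ?thesis using \<eta>(2) by (simp add: distrib_right)
        qed
        finally show "dist x p - 3 * m / 8 \<le> a n x" using elim by linarith
      qed
    qed
    with a show ?thesis by blast
  qed
  have diam: "vnorm L.Q (vdiff L.Q A B) \<le> 1"
    if A: "A \<in> slice L.Q \<phi> (m / 4)" and B: "B \<in> slice L.Q \<phi> (m / 4)" for A B
  proof -
    obtain a where a: "a \<in> vcarrier (linf_space (Lip0 p))" "A = L.cls a"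
      "\<forall>\<^sub>F n in U. \<forall>x. dist x p - 3 * m / 8 \<le> a n x \<and> a n x \<le> dist x p + m / 8"
      using rep[OF A] by blast
    obtain b where b: "b \<in> vcarrier (linf_space (Lip0 p))" "B = L.cls b"
      "\<forall>\<^sub>F n in U. \<forall>x. dist x p - 3 * m / 8 \<le> b n x \<and> b n x \<le> dist x p + m / 8"
      using rep[OF B] by blast
    let ?c = "vdiff (linf_space (Lip0 p)) a b"
    have c: "?c \<in> vcarrier (linf_space (Lip0 p))" using a(1) b(1) by (rule L.diff_closed)
    have "\<forall>\<^sub>F n in U. vnorm (Lip0 p) (?c n) \<le> 1"
      using a(3) b(3)
    proof eventually_elim
      case (elim n)
      \<comment> \<open>At each point both functions lie in the same interval of length
        \<open>m / 2\<close>. Their difference is thus between \<open>- m / 2\<close> and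
        \<open>m / 2\<close>, and two such values differ by at most \<open>m\<close>, hence by at
        most \<open>dist x y\<close>.\<close>
      have "?c n x - ?c n y \<le> 1 * dist x y" for x y
      proof (cases "x = y")
        case False
        have "?c n x - ?c n y = (a n x - b n x) - (a n y - b n y)"
          by (simp add: vdiff_linf_space vdiff_Lip0)
        also have "\<dots> \<le> m"
          using elim(1)[rule_format, of x] elim(1)[rule_format, of y]
            elim(2)[rule_format, of x] elim(2)[rule_format, of y] by linarith
        finally show ?thesis using m(2)[OF False] by simp
      qed simp
      then have "1-lipschitz_on UNIV (?c n)" by (rule lipschitz_on_realI) simp
      moreover have "?c n p = 0"
        using a(1) b(1) by (simp add: vdiff_linf_space vdiff_Lip0)
      ultimately show ?case using norm_Lip0_le_iff[of "?c n" p 1] by simp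
    qed
    then have "vnorm L.Q (L.cls ?c) \<le> 1"
      using norm_ultrapower_le[OF c, of 1 U] by (simp only: up)
    then show ?thesis using L.quotient_diff[OF a(1) b(1)] a(2) b(2) by simp
  qed
  let ?S = "slice L.Q \<phi> (m / 4)"
  have "is_slice L.Q ?S" using \<phi> m(1) unfolding is_slice_def by (intro bexI exI[of _ "m / 4"]) auto
  moreover have "SD2P L.Q"
    using \<open>USD2P (Lip0 p)\<close> U unfolding USD2P_def up[symmetric] by blast
  ultimately have "vdiameter L.Q ?S = 2" by (rule Q.SD2P_vdiameter_slice[rotated])
  moreover have "vdiameter L.Q ?S \<le> 1" by (intro vdiameter_le diam zero_le_one)
  ultimately show False by linarith
qed

lemma infinite_compact_not_uniform_discrete:
  assumes "compact (UNIV :: 'a::metric_space set)" "infinite (UNIV :: 'a set)"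
  shows "\<not> uniform_discrete (UNIV :: 'a set)"
  using assms uniform_discrete_imp_discrete discrete_compact_finite_iff by blast

theorem theorem4p2:
  fixes p :: "'a::metric_space"
  shows "(\<not> uniform_discrete (UNIV :: 'a set) \<longrightarrow> USD2P (Lip0 p)) \<and>
         (compact (UNIV :: 'a set) \<longrightarrow> (USD2P (Lip0 p) \<longleftrightarrow> infinite (UNIV :: 'a set))) \<and>
         (\<not> bounded (UNIV :: 'a set) \<longrightarrow> USD2P (Lip0 p))"
proof -
  interpret seminormed "Lip0 p" by (rule seminormed_Lip0)
  have "USD2P (Lip0 p)" if "\<not> uniform_discrete (UNIV :: 'a set)"
    using spreadable_Lip0[OF scattered_pairs_not_uniform_discrete[OF that]] by (rule spreadable_imp_USD2P)
  moreover have "USD2P (Lip0 p)" if "\<not> bounded (UNIV :: 'a set)"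
    using spreadable_Lip0[OF scattered_pairs_unbounded[OF that]] by (rule spreadable_imp_USD2P)
  \<comment> \<open>For compact spaces the infinite case reduces to the one that is not uniformly
    discrete, and the finite case is excluded.\<close>
  moreover note not_USD2P_finite[of p] infinite_compact_not_uniform_discrete[where 'a = 'a]
  ultimately show ?thesis by blast
qed

end
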